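(* Let $T>0$, let $\{B_t\}_{t\in[0,T]}$ be a one-dimensional Brownian motion, let $h:[0,T]\times\mathbb R\to\mathbb R_+$ be a Hurst function with parameters $(h_*,h^* )$, and let $X^h$ be the solution of $$X_t^h=\int_0^t (t-s)^{h(t,X_s^h)-\frac12}\,dB_s,\qquad t\in[0,T].$$ For $N\in\mathbb N$, let $\Delta t=T/N$, $t_i=i\Delta t$, $\eta(s)=t_i$ for $s\in[t_i,t_{i+1})$, and let $\bar X^h$ be the (continuous-time) Euler–Maruyama scheme $$\bar X_t^h=\int_0^t (t-\eta(s))^{h(t,\bar X^h_{\eta(s)})-\frac12}\,dB_s,\qquad t\in[0,T].$$ Then for every $\gamma\in(0,2h_* )$ there is a positive constant $C_{T,\gamma,h_*}$, not depending on $N$, such that $$\sup_{0\le t\le T}\mathbb E\big[|X_t^h-\bar X_t^h|^2\big]\le C_{T,\gamma,h_*}\,E_{h_*}\!\big(C_{T,\gamma,h_*}\Gamma(h_* )T^{h_*}\big)\,|\Delta t|^{\gamma}.$$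
   Context: Hurst function: $h:[0,T]\times\mathbb R\to\mathbb R_+$ is a Hurst function with parameters $(h_*,h^* )$, $h_*\le h^*$, if $h(t,x)\in[h_*,h^*]\subset(0,1)$ for all $(t,x)\in[0,T]\times\mathbb R$ and there is $C>0$ with $|h(t,x)-h(t,y)|\le C|x-y|$ and $|h(t,x)-h(t',x)|\le C|t-t'|$ for all $x,y\in\mathbb R$, $t,t'\in[0,T]$. $\Gamma$ is the Gamma function and $E_\beta(z)=\sum_{k=0}^\infty \frac{z^k}{\Gamma(k\beta+1)}$ is the Mittag-Leffler function. The equation for $X^h$ has a unique (up to modification) measurable adapted solution; equations are understood almost surely for each $t$. The scheme $\bar X^h$ is defined recursively, since its value at $t$ depends only on its values at grid points $t_i<t$, and $\bar X^h_0=0$. The constant may depend on $h$ (including its Lipschitz constant and $h^*$), $T$ and $\gamma$, but not on $N$. *)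

theory Defs
  imports "HOL-Probability.Probability"
begin

definition hurst_function :: "real \<Rightarrow> real \<Rightarrow> real \<Rightarrow> (real \<Rightarrow> real \<Rightarrow> real) \<Rightarrow> bool" where
  "hurst_function T hlo hhi h \<longleftrightarrow>
     0 < hlo \<and> hlo \<le> hhi \<and> hhi < 1 \<and>
     (\<forall>t\<in>{0..T}. \<forall>x. h t x \<in> {hlo..hhi}) \<and>
     (\<exists>C>0. (\<forall>t\<in>{0..T}. \<forall>x y. \<bar>h t x - h t y\<bar> \<le> C * \<bar>x - y\<bar>) \<and>
            (\<forall>t\<in>{0..T}. \<forall>t'\<in>{0..T}. \<forall>x. \<bar>h t x - h t' x\<bar> \<le> C * \<bar>t - t'\<bar>))"

definition mittag_leffler :: "real \<Rightarrow> real \<Rightarrow> real" where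
  "mittag_leffler \<beta> z = (\<Sum>k. z ^ k / Gamma (real k * \<beta> + 1))"

text \<open>Brownian motion on \<open>{0..T}\<close> relative to a filtration \<open>F\<close>, which need not be the one generated
  by \<open>B\<close> and need not be complete. The filtration is indexed by all reals only because of the
  library locale; a filtration indexed by \<open>{0..T}\<close> extends constantly to the left and right, and
  nothing below refers to the added part.\<close>

locale brownian_motion = prob_space M + filtration "space M" F
  for M :: "'a measure" and F :: "real \<Rightarrow> 'a measure" and T :: real and B :: "real \<Rightarrow> 'a \<Rightarrow> real" +
  assumes sub: "t \<in> {0..T} \<Longrightarrow> subalgebra M (F t)"
    and adapted: "t \<in> {0..T} \<Longrightarrow> B t \<in> borel_measurable (F t)"
    and start: "AE \<omega> in M. B 0 \<omega> = 0"
    and gaussian_increments: "0 \<le> s \<Longrightarrow> s < t \<Longrightarrow> t \<le> T \<Longrightarrow>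
          distributed M lborel (\<lambda>\<omega>. B t \<omega> - B s \<omega>) (normal_density 0 (sqrt (t - s)))"
    and indep_increments: "0 \<le> s \<Longrightarrow> s < t \<Longrightarrow> t \<le> T \<Longrightarrow>
          indep_set (sets (F s)) (sets (vimage_algebra (space M) (\<lambda>\<omega>. B t \<omega> - B s \<omega>) borel))"
    and continuous_paths: "AE \<omega> in M. continuous_on {0..T} (\<lambda>t. B t \<omega>)"

text \<open>The simple process \<open>\<Sum>i<n. \<xi>\<^sub>i 1_(\<tau>\<^sub>i, \<tau>\<^sub>i\<^sub>+\<^sub>1]\<close> on \<open>{0..t}\<close> is represented by the triple \<open>n\<close>, \<open>\<tau>\<close>, \<open>\<xi>\<close>.\<close>

definition simple_integrand ::
  "(real \<Rightarrow> 'a measure) \<Rightarrow> real \<Rightarrow> nat \<Rightarrow> (nat \<Rightarrow> real) \<Rightarrow> (nat \<Rightarrow> 'a \<Rightarrow> real) \<Rightarrow> bool" where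
  "simple_integrand F t n \<tau> \<xi> \<longleftrightarrow>
     \<tau> 0 = 0 \<and> \<tau> n = t \<and> (\<forall>i<n. \<tau> i \<le> \<tau> (Suc i)) \<and>
     (\<forall>i<n. \<xi> i \<in> borel_measurable (F (\<tau> i)) \<and> bounded (\<xi> i ` space (F (\<tau> i))))"

definition simple_process ::
  "nat \<Rightarrow> (nat \<Rightarrow> real) \<Rightarrow> (nat \<Rightarrow> 'a \<Rightarrow> real) \<Rightarrow> real \<Rightarrow> 'a \<Rightarrow> real" where
  "simple_process n \<tau> \<xi> s \<omega> = (\<Sum>i<n. \<xi> i \<omega> * indicator {\<tau> i<..\<tau> (Suc i)} s)"

definition simple_ito_integral ::
  "(real \<Rightarrow> 'a \<Rightarrow> real) \<Rightarrow> nat \<Rightarrow> (nat \<Rightarrow> real) \<Rightarrow> (nat \<Rightarrow> 'a \<Rightarrow> real) \<Rightarrow> 'a \<Rightarrow> real" where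
  "simple_ito_integral B n \<tau> \<xi> \<omega> = (\<Sum>i<n. \<xi> i \<omega> * (B (\<tau> (Suc i)) \<omega> - B (\<tau> i) \<omega>))"

abbreviation time_space :: "'a measure \<Rightarrow> real \<Rightarrow> (real \<times> 'a) measure" where
  "time_space M t \<equiv> restrict_space lborel {0..t} \<Otimes>\<^sub>M M"

definition measurable_adapted ::
  "'a measure \<Rightarrow> (real \<Rightarrow> 'a measure) \<Rightarrow> real \<Rightarrow> (real \<Rightarrow> 'a \<Rightarrow> real) \<Rightarrow> bool" where
  "measurable_adapted M F t f \<longleftrightarrow>
     (\<lambda>(s, \<omega>). f s \<omega>) \<in> borel_measurable (time_space M t) \<and>
     (\<forall>s\<in>{0..t}. f s \<in> borel_measurable (F s))"

text \<open>\<open>I\<close> is a version of the stochastic integral of \<open>f\<close> over \<open>{0..t}\<close> against \<open>B\<close>: the \<open>L\<^sup>2\<close>-limit of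
  the integrals of simple processes approximating \<open>f\<close> in \<open>L\<^sup>2(dt \<otimes> P)\<close>. As \<open>I\<close> is only determined up
  to null sets, \<open>has_ito_integral M F B t f I\<close> expresses that \<open>I\<close> equals the integral almost surely.\<close>

definition has_ito_integral ::
  "'a measure \<Rightarrow> (real \<Rightarrow> 'a measure) \<Rightarrow> (real \<Rightarrow> 'a \<Rightarrow> real) \<Rightarrow> real \<Rightarrow>
   (real \<Rightarrow> 'a \<Rightarrow> real) \<Rightarrow> ('a \<Rightarrow> real) \<Rightarrow> bool" where
  "has_ito_integral M F B t f I \<longleftrightarrow>
     measurable_adapted M F t f \<and>
     (\<integral>\<^sup>+(s, \<omega>). ennreal ((f s \<omega>)\<^sup>2) \<partial>time_space M t) < \<infinity> \<and>
     I \<in> borel_measurable M \<and>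
     (\<exists>n \<tau> \<xi>. (\<forall>k. simple_integrand F t (n k) (\<tau> k) (\<xi> k)) \<and>
        ((\<lambda>k. \<integral>\<^sup>+(s, \<omega>). ennreal ((f s \<omega> - simple_process (n k) (\<tau> k) (\<xi> k) s \<omega>)\<^sup>2)
                \<partial>time_space M t) \<longlonglongrightarrow> 0) \<and>
        ((\<lambda>k. \<integral>\<^sup>+\<omega>. ennreal ((I \<omega> - simple_ito_integral B (n k) (\<tau> k) (\<xi> k) \<omega>)\<^sup>2) \<partial>M)
           \<longlonglongrightarrow> 0))"

text \<open>In the two kernels below the base of \<open>powr\<close> vanishes at most on a null set of times \<open>s\<close>
  (namely at \<open>s = t\<close>), so the convention \<open>0 powr a = 0\<close> does not affect the integrals.\<close>

definition volterra_solution ::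
  "'a measure \<Rightarrow> (real \<Rightarrow> 'a measure) \<Rightarrow> real \<Rightarrow> (real \<Rightarrow> 'a \<Rightarrow> real) \<Rightarrow> (real \<Rightarrow> real \<Rightarrow> real) \<Rightarrow>
   (real \<Rightarrow> 'a \<Rightarrow> real) \<Rightarrow> bool" where
  "volterra_solution M F T B h X \<longleftrightarrow>
     measurable_adapted M F T X \<and>
     (\<forall>t\<in>{0..T}. has_ito_integral M F B t (\<lambda>s \<omega>. (t - s) powr (h t (X s \<omega>) - 1/2)) (X t))"

definition grid_floor :: "real \<Rightarrow> real \<Rightarrow> real" where
  "grid_floor \<Delta> s = of_int \<lfloor>s / \<Delta>\<rfloor> * \<Delta>"

lemma grid_floor_eq:
  assumes "0 < \<Delta>" "s \<in> {real i * \<Delta>..<real (Suc i) * \<Delta>}"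
  shows "grid_floor \<Delta> s = real i * \<Delta>"
proof -
  have "\<lfloor>s / \<Delta>\<rfloor> = int i"
    using assms by (intro floor_unique) (auto simp: field_simps)
  then show ?thesis by (simp add: grid_floor_def)
qed

text \<open>The value \<open>Y t\<close> is determined, up to null sets, by the values of \<open>Y\<close> at grid points before \<open>t\<close>;
  taking \<open>t = 0\<close> gives \<open>Y 0 = 0\<close> almost surely.\<close>

definition euler_maruyama_scheme ::
  "'a measure \<Rightarrow> (real \<Rightarrow> 'a measure) \<Rightarrow> real \<Rightarrow> (real \<Rightarrow> 'a \<Rightarrow> real) \<Rightarrow> (real \<Rightarrow> real \<Rightarrow> real) \<Rightarrow>
   nat \<Rightarrow> (real \<Rightarrow> 'a \<Rightarrow> real) \<Rightarrow> bool" where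
  "euler_maruyama_scheme M F T B h N Y \<longleftrightarrow>
     (\<forall>t\<in>{0..T}. has_ito_integral M F B t
        (\<lambda>s \<omega>. (t - grid_floor (T / real N) s) powr
                 (h t (Y (grid_floor (T / real N) s) \<omega>) - 1/2)) (Y t))"

end

theory Submission
  imports Defs
begin

text \<open>
  Both \<open>X t\<close> and \<open>Y t\<close> are stochastic integrals over \<open>{0..t}\<close>, so the Ito isometry turns the mean
  square error at time \<open>t\<close> into a time integral of the expected squared difference of the two kernels.
  Everything else rests on one deterministic estimate (\<open>kernel_difference\<close>): with exponents \<open>a\<close>, \<open>b\<close> in
  the range of \<open>h - 1/2\<close> and \<open>0 < x \<le> y \<le> T\<close>,
  \<open>\<bar>x powr a - y powr b\<bar> \<le> const * x powr - \<kappa> * (\<bar>a - b\<bar> + (y - x) powr \<theta>)\<close>,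
  where \<open>\<theta> = hlo - 1/2 + \<kappa>\<close>. The same singular weight serves for a change of the exponent, where it
  absorbs a logarithm, and for a change of the base. The choice \<open>\<kappa> = max (1/2 + \<gamma>/2 - hlo) 0\<close> makes
  \<open>2 * \<kappa> < 1\<close>, so that the squared weight is integrable, and \<open>2 * \<theta> \<ge> \<gamma>\<close>, so that the rate is as
  claimed.

  Applied to \<open>X t - X s\<close>, the estimate yields mean square increments of order \<open>\<bar>t - s\<bar> powr (2 * \<theta>)\<close>
  (\<open>solution_increment\<close>). Applied to \<open>X t - Y t\<close>, with the value of \<open>X\<close> at the preceding grid point
  inserted, it yields a recursion for the error (\<open>error_recursion\<close>):
  the error at \<open>t\<close> is at most a constant times \<open>(T / N) powr (2 * \<theta>)\<close> plus an integral
  of the errors at grid points \<open>\<eta> s \<le> s\<close> against the kernel \<open>(t - s) powr - (2 * \<kappa>)\<close>. A Gronwall lemma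
  for such kernels (\<open>singular_gronwall\<close>) closes the recursion with a constant that does not depend on
  \<open>N\<close> or on the probability space. The Mittag-Leffler factor is at least \<open>1\<close> at nonnegative
  arguments, so a bound by a constant multiple of \<open>(T / N) powr \<gamma>\<close> already has the claimed form.

  The stochastic integrals to be compared come with approximating simple processes on unrelated
  partitions, possibly of different intervals. The isometry for elementary integrands is therefore
  proved for arbitrary finite families of intervals (\<open>elementary_isometry\<close>), from the covariance of
  two weighted increments; no common refinement is formed.
\<close>

section \<open>Elementary estimates for powers\<close>

text \<open>Near \<open>0\<close> the logarithm is dominated by \<open>x powr - \<theta> / \<theta>\<close>; for \<open>x \<ge> 1\<close> both factors are at most \<open>T\<close>.\<close>
lemma abs_ln_times_powr_le:
  fixes x c \<theta> T :: real
  assumes "0 < x" "x \<le> T" "0 < \<theta>" "\<theta> \<le> c" "c \<le> 1"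
  shows "\<bar>ln x\<bar> * x powr c \<le> 1/\<theta> + T\<^sup>2"
proof (cases "x \<le> 1")
  case True
  have "ln (1/x) \<le> (1/x) powr \<theta> / \<theta>" using assms True by (intro ln_powr_bound) auto
  then have "\<bar>ln x\<bar> \<le> x powr - \<theta> / \<theta>" using True assms by (simp add: ln_div powr_minus powr_divide field_simps)
  then have "\<bar>ln x\<bar> * x powr c \<le> x powr - \<theta> / \<theta> * x powr c" by (intro mult_right_mono) auto
  also have "\<dots> = x powr (c - \<theta>) / \<theta>" by (simp add: powr_diff powr_minus field_simps)
  also have "\<dots> \<le> 1 / \<theta>" using assms True powr_mono2[of "c - \<theta>" x 1] by (simp add: divide_right_mono)
  also have "\<dots> \<le> 1 / \<theta> + T\<^sup>2" by simp
  finally show ?thesis .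
next
  case False
  have "ln x \<le> T" using assms ln_le_minus_one[of x] by simp
  moreover have "x powr c \<le> T"
    using powr_mono[of c 1 x] assms False by simp
  ultimately have "\<bar>ln x\<bar> * x powr c \<le> T * T" using False assms by (intro mult_mono) auto
  then show ?thesis using assms by (simp add: power2_eq_square add_increasing)
qed

text \<open>Mean value theorem in the exponent. The derivative carries a factor \<open>ln x\<close>, which \<open>x powr \<theta>\<close> absorbs;
  this is why the weight is strictly more singular than the powers themselves.\<close>
lemma powr_diff_exponent_le:
  fixes x a b \<kappa> \<theta> T :: real
  assumes x: "0 < x" "x \<le> T" and \<theta>: "0 < \<theta>" and a: "a + \<kappa> \<in> {\<theta>..1}" and b: "b + \<kappa> \<in> {\<theta>..1}"
  shows "\<bar>x powr a - x powr b\<bar> \<le> (1/\<theta> + T\<^sup>2) * x powr - \<kappa> * \<bar>a - b\<bar>"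
  using a b
proof (induction a b rule: linorder_wlog)
  case (le a b)
  show ?case
  proof (cases "a = b")
    case False
    with le have "a < b" by simp
    have "\<And>u. ((\<lambda>u. x powr u) has_real_derivative x powr u * ln x) (at u)"
      using x by (auto intro!: derivative_eq_intros)
    from MVT2[OF \<open>a < b\<close> this]
    obtain c where c: "a < c" "c < b" "x powr b - x powr a = (b - a) * (x powr c * ln x)" by blast
    have "\<bar>x powr a - x powr b\<bar> = \<bar>a - b\<bar> * (\<bar>ln x\<bar> * x powr (c + \<kappa>) * x powr - \<kappa>)"
    proof -
      have "\<bar>x powr a - x powr b\<bar> = \<bar>x powr b - x powr a\<bar>" by simp
      also have "\<dots> = \<bar>a - b\<bar> * (\<bar>ln x\<bar> * x powr c)" unfolding c(3) by (simp add: abs_mult abs_minus_commute)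
      also have "x powr c = x powr (c + \<kappa>) * x powr - \<kappa>" by (simp flip: powr_add)
      finally show ?thesis by simp
    qed
    also have "\<dots> \<le> \<bar>a - b\<bar> * ((1/\<theta> + T\<^sup>2) * x powr - \<kappa>)"
      using c le x \<theta> by (intro mult_left_mono mult_right_mono abs_ln_times_powr_le) auto
    finally show ?thesis by (simp add: mult_ac)
  qed simp
next
  case (sym a b)
  then show ?case by (simp add: abs_minus_commute)
qed

text \<open>Since \<open>u \<le> u powr \<theta>\<close> on the unit interval, the parts \<open>x / y\<close> and \<open>(y - x) / y\<close> of \<open>1\<close> have
  powers that sum to at least \<open>1\<close>.\<close>
lemma powr_subadditive:
  fixes x y \<theta> :: real
  assumes "0 < x" "x \<le> y" "0 < \<theta>" "\<theta> \<le> 1"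
  shows "y powr \<theta> - x powr \<theta> \<le> (y - x) powr \<theta>"
proof -
  have *: "u \<le> u powr \<theta>" if "0 \<le> u" "u \<le> 1" for u :: real
    using that assms powr_mono'[of \<theta> 1 u] by (cases "u = 0") auto
  have "1 = x / y + (y - x) / y" using assms by (simp add: field_simps)
  also have "\<dots> \<le> (x / y) powr \<theta> + ((y - x) / y) powr \<theta>"
    using assms by (intro add_mono *) auto
  also have "\<dots> = (x powr \<theta> + (y - x) powr \<theta>) / y powr \<theta>"
    using assms by (simp add: powr_divide add_divide_distrib)
  finally show ?thesis using assms by (simp add: field_simps)
qed

lemma powr_le_one_plus:
  fixes x e T :: real
  assumes "0 < x" "x \<le> T" "0 \<le> e" "e \<le> 1"
  shows "x powr e \<le> 1 + T"
proof (cases "x \<le> 1")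
  case True
  then have "x powr e \<le> 1" using assms powr_mono2[of e x 1] by simp
  then show ?thesis using assms by simp
next
  case False
  then show ?thesis using assms powr_mono[of e 1 x] by simp
qed

text \<open>Cauchy's mean value theorem compares \<open>z powr a\<close> with \<open>z powr \<theta>\<close>. This gives the Hoelder exponent \<open>\<theta>\<close>
  for positive, negative and zero \<open>a\<close> alike.\<close>
lemma powr_diff_base_le:
  fixes x y a \<kappa> \<theta> T :: real
  assumes xy: "0 < x" "x \<le> y" "y \<le> T" and \<theta>: "0 < \<theta>" "\<theta> \<le> 1" and "\<bar>a\<bar> \<le> 1" "0 \<le> \<kappa>"
    and a: "a + \<kappa> - \<theta> \<in> {0..1}"
  shows "\<bar>x powr a - y powr a\<bar> \<le> (1 + T) / \<theta> * x powr - \<kappa> * (y - x) powr \<theta>"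
proof (cases "x = y")
  case False
  with xy have "x < y" by simp
  have d: "((\<lambda>z. z powr c) has_real_derivative c * z powr (c - 1)) (at z)" if "x < z" for z c
    using that xy by (auto intro!: derivative_eq_intros)
  obtain z where z: "x < z" "z < y"
    and eq: "(y powr a - x powr a) * (\<theta> * z powr (\<theta> - 1)) = (y powr \<theta> - x powr \<theta>) * (a * z powr (a - 1))"
    using GMVT'[OF \<open>x < y\<close>, of "\<lambda>z. z powr a" "\<lambda>z. z powr \<theta>" "\<lambda>z. \<theta> * z powr (\<theta> - 1)" "\<lambda>z. a * z powr (a - 1)"]
      d xy by (force intro!: continuous_intros)
  have z0: "0 < z" using z xy by simp
  have inc: "0 \<le> y powr \<theta> - x powr \<theta>" using xy \<theta> by (simp add: powr_mono2)
  have "y powr a - x powr a = (y powr \<theta> - x powr \<theta>) * (a * z powr (a - 1)) / (\<theta> * z powr (\<theta> - 1))"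
    using eq z0 \<theta> by (simp add: field_simps)
  also have "\<dots> = a / \<theta> * (y powr \<theta> - x powr \<theta>) * z powr (a - \<theta>)"
  proof -
    have "z powr (a - 1) = z powr (a - \<theta>) * z powr (\<theta> - 1)" by (simp flip: powr_add)
    then show ?thesis using z0 by simp
  qed
  finally have "\<bar>x powr a - y powr a\<bar> = \<bar>a\<bar> / \<theta> * (y powr \<theta> - x powr \<theta>) * z powr (a - \<theta>)"
    using inc \<theta> by (subst abs_minus_commute) (simp add: abs_mult)
  also have "\<dots> \<le> 1 / \<theta> * (y - x) powr \<theta> * ((1 + T) * x powr - \<kappa>)"
  proof (intro mult_mono)
    have "z powr (a - \<theta>) = z powr (a + \<kappa> - \<theta>) * z powr - \<kappa>" by (simp flip: powr_add)
    also have "\<dots> \<le> (1 + T) * x powr - \<kappa>"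
      using assms z z0 by (intro mult_mono powr_le_one_plus powr_mono2') auto
    finally show "z powr (a - \<theta>) \<le> (1 + T) * x powr - \<kappa>" .
  qed (use assms inc powr_subadditive in \<open>auto intro: divide_right_mono\<close>)
  finally show ?thesis by (simp add: mult_ac)
qed (use assms in simp)

section \<open>A Gronwall lemma with singular kernel\<close>

lemma nn_integral_powr_singular:
  fixes s t \<alpha> :: real
  assumes "s \<le> t" "\<alpha> < 1"
  shows "(\<integral>\<^sup>+u. indicator {s..t} u * ennreal ((t - u) powr - \<alpha>) \<partial>lborel)
    = ennreal ((t - s) powr (1 - \<alpha>) / (1 - \<alpha>))"
proof -
  have "(\<integral>\<^sup>+u. indicator {s..t} u * ennreal ((t - u) powr - \<alpha>) \<partial>lborel)
     = (\<integral>\<^sup>+u. ennreal (u powr - \<alpha>) * indicator {0..t - s} u \<partial>lborel)"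
    by (subst nn_integral_real_affine[where c="-1" and t=t])
       (auto simp: indicator_def intro!: nn_integral_cong)
  also have "\<dots> = ennreal ((t - s) powr (1 - \<alpha>) / (1 - \<alpha>))"
    using nn_integral_has_integral_lebesgue'[OF _ has_integral_powr_from_0[of "- \<alpha>" "t - s"]] assms
    by simp
  finally show ?thesis .
qed

lemma exp_minus_le_powr:
  fixes z \<epsilon> :: real
  assumes "0 < z" "0 \<le> \<epsilon>" "\<epsilon> \<le> 1"
  shows "exp (- z) \<le> z powr - \<epsilon>"
proof -
  have "z powr \<epsilon> \<le> 1 + z" using powr_le_one_plus[of z z \<epsilon>] assms by simp
  also have "\<dots> \<le> exp z" by (rule exp_ge_add_one_self)
  finally show ?thesis using assms by (simp add: exp_minus powr_minus field_simps)
qed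

text \<open>In the norm \<open>SUP t. f t * exp (- \<rho> * t)\<close> the integral operator has norm at most \<open>1/2\<close> once \<open>\<rho>\<close> is
  large: the factor \<open>exp (- \<rho> * (t - s))\<close> is at most \<open>(\<rho> * (t - s)) powr - \<epsilon>\<close>, where \<open>\<epsilon>\<close> is small enough
  to keep the kernel integrable. The a priori bound \<open>R\<close> makes the norm finite, so that it can be
  absorbed; it leaves no trace in the constant. Delaying \<open>f\<close> by \<open>\<eta>\<close> is harmless because \<open>exp (\<rho> * s)\<close>
  increases with \<open>s\<close>.\<close>
lemma singular_gronwall:
  fixes T K \<alpha> :: real
  assumes T: "0 \<le> T" and K: "0 \<le> K" and \<alpha>: "0 \<le> \<alpha>" "\<alpha> < 1"
  shows "\<exists>C>0. \<forall>(f :: real \<Rightarrow> ennreal) \<eta> A R. 0 \<le> A \<longrightarrow>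
    (\<forall>t\<in>{0..T}. f t \<le> ennreal R) \<longrightarrow>
    (\<forall>s\<in>{0..T}. \<eta> s \<in> {0..s}) \<longrightarrow>
    (\<forall>t\<in>{0..T}. f t \<le> ennreal A
       + (\<integral>\<^sup>+s. indicator {0..t} s * (ennreal (K * (t - s) powr - \<alpha>) * f (\<eta> s)) \<partial>lborel)) \<longrightarrow>
    (\<forall>t\<in>{0..T}. f t \<le> ennreal (C * A))"
proof -
  define \<epsilon> where "\<epsilon> = (1 - \<alpha>) / 2"
  have \<epsilon>: "0 < \<epsilon>" "\<epsilon> \<le> 1" "\<alpha> + \<epsilon> < 1" using \<alpha> by (auto simp: \<epsilon>_def field_simps)
  define J where "J = T powr (1 - (\<alpha> + \<epsilon>)) / (1 - (\<alpha> + \<epsilon>))"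
  have J: "0 \<le> J" using \<epsilon> by (simp add: J_def)
  \<comment> \<open>chosen so that \<open>K * \<rho> powr - \<epsilon> * J = K * J / (2 * K * J + 1)\<close>\<close>
  define \<rho> where "\<rho> = (2 * K * J + 1) powr (1 / \<epsilon>)"
  have base: "0 < 2 * K * J + 1" using K J by (simp add: add_nonneg_pos)
  have \<rho>: "0 < \<rho>" using base by (simp add: \<rho>_def)
  have half: "K * (\<rho> powr - \<epsilon> * J) \<le> 1 / 2"
  proof -
    have "\<rho> powr - \<epsilon> = inverse (2 * K * J + 1)"
      using base \<epsilon> by (simp add: \<rho>_def powr_powr powr_minus)
    then have "K * (\<rho> powr - \<epsilon> * J) = K * J / (2 * K * J + 1)" by (simp add: field_simps)
    also have "\<dots> \<le> 1 / 2" using base by (simp add: pos_divide_le_eq)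
    finally show ?thesis .
  qed
  have kernel: "(\<integral>\<^sup>+s. indicator {0..t} s * ennreal (K * (t - s) powr - \<alpha> * exp (\<rho> * s)) \<partial>lborel)
     \<le> ennreal (exp (\<rho> * t) / 2)" if t: "t \<in> {0..T}" for t
  proof -
    have "(\<integral>\<^sup>+s. indicator {0..t} s * ennreal (K * (t - s) powr - \<alpha> * exp (\<rho> * s)) \<partial>lborel)
      \<le> (\<integral>\<^sup>+s. ennreal (exp (\<rho> * t) * (K * \<rho> powr - \<epsilon>)) *
            (indicator {0..t} s * ennreal ((t - s) powr - (\<alpha> + \<epsilon>))) \<partial>lborel)"
    proof (intro nn_integral_mono)
      fix s :: real
      show "indicator {0..t} s * ennreal (K * (t - s) powr - \<alpha> * exp (\<rho> * s))
        \<le> ennreal (exp (\<rho> * t) * (K * \<rho> powr - \<epsilon>)) * (indicator {0..t} s * ennreal ((t - s) powr - (\<alpha> + \<epsilon>)))"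
      proof (cases "0 \<le> s \<and> s < t")
        case True
        have "exp (\<rho> * s) = exp (\<rho> * t) * exp (- (\<rho> * (t - s)))" by (simp add: algebra_simps flip: exp_add)
        also have "exp (- (\<rho> * (t - s))) \<le> (\<rho> * (t - s)) powr - \<epsilon>"
          using True \<rho> \<epsilon> by (intro exp_minus_le_powr) auto
        also have "\<dots> = \<rho> powr - \<epsilon> * (t - s) powr - \<epsilon>" using True \<rho> by (simp add: powr_mult)
        finally have "K * (t - s) powr - \<alpha> * exp (\<rho> * s)
            \<le> K * (t - s) powr - \<alpha> * (exp (\<rho> * t) * (\<rho> powr - \<epsilon> * (t - s) powr - \<epsilon>))"
          using K by (intro mult_left_mono) auto
        also have "\<dots> = exp (\<rho> * t) * (K * \<rho> powr - \<epsilon>) * ((t - s) powr - \<alpha> * (t - s) powr - \<epsilon>)"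
          by (simp add: mult_ac)
        also have "(t - s) powr - \<alpha> * (t - s) powr - \<epsilon> = (t - s) powr - (\<alpha> + \<epsilon>)"
          by (simp flip: powr_add)
        finally show ?thesis using True K by (simp flip: ennreal_mult')
      qed (auto simp: indicator_def)
    qed
    also have "\<dots> = ennreal (exp (\<rho> * t) * (K * \<rho> powr - \<epsilon>)) * ennreal (t powr (1 - (\<alpha> + \<epsilon>)) / (1 - (\<alpha> + \<epsilon>)))"
      using nn_integral_powr_singular[of 0 t "\<alpha> + \<epsilon>"] t \<epsilon> by (subst nn_integral_cmult) auto
    also have "\<dots> = ennreal (exp (\<rho> * t) * (K * \<rho> powr - \<epsilon>) * (t powr (1 - (\<alpha> + \<epsilon>)) / (1 - (\<alpha> + \<epsilon>))))"
      using K by (subst ennreal_mult') auto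
    also have "\<dots> \<le> ennreal (exp (\<rho> * t) * (K * \<rho> powr - \<epsilon>) * J)"
      unfolding J_def using t K \<epsilon> by (intro ennreal_leI mult_left_mono divide_right_mono powr_mono2) auto
    also have "\<dots> \<le> ennreal (exp (\<rho> * t) / 2)"
      using mult_left_mono[OF half, of "exp (\<rho> * t)"] by (intro ennreal_leI) (simp add: mult_ac)
    finally show ?thesis .
  qed
  show ?thesis
  proof (intro exI[of _ "2 * exp (\<rho> * T)"] conjI allI impI ballI)
    fix f :: "real \<Rightarrow> ennreal" and \<eta> A R t
    assume A: "0 \<le> A" and R: "\<forall>t\<in>{0..T}. f t \<le> ennreal R" and \<eta>: "\<forall>s\<in>{0..T}. \<eta> s \<in> {0..s}"
      and rec: "\<forall>t\<in>{0..T}. f t \<le> ennreal A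
       + (\<integral>\<^sup>+s. indicator {0..t} s * (ennreal (K * (t - s) powr - \<alpha>) * f (\<eta> s)) \<partial>lborel)"
      and tT: "t \<in> {0..T}"
    define S where "S = (SUP t\<in>{0..T}. f t * ennreal (exp (- (\<rho> * t))))"
    have fS: "f t \<le> S * ennreal (exp (\<rho> * t))" if "t \<in> {0..T}" for t
    proof -
      have "f t = f t * ennreal (exp (- (\<rho> * t))) * ennreal (exp (\<rho> * t))"
        by (simp add: mult.assoc flip: ennreal_mult' exp_add)
      also have "\<dots> \<le> S * ennreal (exp (\<rho> * t))"
        unfolding S_def using that by (intro mult_right_mono SUP_upper) auto
      finally show ?thesis .
    qed
    have "S \<le> ennreal R"
      unfolding S_def
    proof (rule SUP_least)
      fix t assume t: "t \<in> {0..T}"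
      then have "f t * ennreal (exp (- (\<rho> * t))) \<le> ennreal R * 1"
        using R \<rho> by (intro mult_mono) auto
      then show "f t * ennreal (exp (- (\<rho> * t))) \<le> ennreal R" by simp
    qed
    then obtain \<sigma> where \<sigma>: "S = ennreal \<sigma>" "0 \<le> \<sigma>"
      by (cases S) (auto simp: top_unique)
    have step: "f t \<le> ennreal (A + exp (\<rho> * t) / 2 * \<sigma>)" if t: "t \<in> {0..T}" for t
    proof -
      have "f t \<le> ennreal A
         + (\<integral>\<^sup>+s. indicator {0..t} s * (ennreal (K * (t - s) powr - \<alpha>) * f (\<eta> s)) \<partial>lborel)"
        using rec t by blast
      also have "(\<integral>\<^sup>+s. indicator {0..t} s * (ennreal (K * (t - s) powr - \<alpha>) * f (\<eta> s)) \<partial>lborel)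
        \<le> (\<integral>\<^sup>+s. (indicator {0..t} s * ennreal (K * (t - s) powr - \<alpha> * exp (\<rho> * s))) * S \<partial>lborel)"
      proof (intro nn_integral_mono)
        fix s :: real
        show "indicator {0..t} s * (ennreal (K * (t - s) powr - \<alpha>) * f (\<eta> s))
           \<le> (indicator {0..t} s * ennreal (K * (t - s) powr - \<alpha> * exp (\<rho> * s))) * S"
        proof (cases "s \<in> {0..t}")
          case True
          then have s: "\<eta> s \<in> {0..T}" "\<eta> s \<le> s" using \<eta> t by fastforce+
          have "f (\<eta> s) \<le> S * ennreal (exp (\<rho> * \<eta> s))" by (rule fS[OF s(1)])
          also have "\<dots> \<le> S * ennreal (exp (\<rho> * s))"
            using s \<rho> by (intro mult_left_mono ennreal_leI) auto
          finally have "ennreal (K * (t - s) powr - \<alpha>) * f (\<eta> s)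
            \<le> ennreal (K * (t - s) powr - \<alpha>) * (S * ennreal (exp (\<rho> * s)))"
            by (rule mult_left_mono) simp
          then show ?thesis using True K by (simp add: ennreal_mult' mult_ac)
        qed simp
      qed
      also have "\<dots> = (\<integral>\<^sup>+s. indicator {0..t} s * ennreal (K * (t - s) powr - \<alpha> * exp (\<rho> * s)) \<partial>lborel) * S"
        by (rule nn_integral_multc) measurable
      also have "\<dots> \<le> ennreal (exp (\<rho> * t) / 2) * S"
        by (intro mult_right_mono kernel t) auto
      finally show ?thesis using A \<sigma> by (simp flip: ennreal_mult ennreal_plus)
    qed
    have "S \<le> ennreal (A + \<sigma> / 2)"
      unfolding S_def
    proof (rule SUP_least)
      fix t assume t: "t \<in> {0..T}"
      have "f t * ennreal (exp (- (\<rho> * t))) \<le> ennreal (A + exp (\<rho> * t) / 2 * \<sigma>) * ennreal (exp (- (\<rho> * t)))"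
        by (intro mult_right_mono step t) simp
      also have "\<dots> = ennreal (A * exp (- (\<rho> * t)) + \<sigma> / 2)"
        using A \<sigma> by (simp add: algebra_simps exp_minus flip: ennreal_mult)
      also have "\<dots> \<le> ennreal (A + \<sigma> / 2)"
        using A t \<rho> by (intro ennreal_leI add_right_mono mult_left_le) auto
      finally show "f t * ennreal (exp (- (\<rho> * t))) \<le> ennreal (A + \<sigma> / 2)" .
    qed
    then have "\<sigma> \<le> 2 * A" using \<sigma> A by (simp del: ennreal_plus)
    have "f t \<le> ennreal \<sigma> * ennreal (exp (\<rho> * t))" using fS[OF tT] \<sigma> by simp
    also have "\<dots> \<le> ennreal (2 * A) * ennreal (exp (\<rho> * T))"
      using \<open>\<sigma> \<le> 2 * A\<close> tT \<rho> by (intro mult_mono ennreal_leI) auto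
    also have "\<dots> = ennreal (2 * exp (\<rho> * T) * A)" using A by (simp add: mult_ac flip: ennreal_mult)
    finally show "f t \<le> ennreal (2 * exp (\<rho> * T) * A)" .
  qed auto
qed

section \<open>Lower bound for the Mittag-Leffler function\<close>

text \<open>The Euler integral restricted to \<open>{R..R + 1}\<close>. As \<open>R\<close> is arbitrary, Gamma outgrows every geometric
  sequence along \<open>k * \<beta> + 1\<close>.\<close>
lemma Gamma_ge_powr:
  fixes x R :: real
  assumes "0 \<le> x" "0 < R"
  shows "R powr x * exp (- (R + 1)) \<le> Gamma (x + 1)"
proof -
  have "ennreal (R powr x * exp (- (R + 1))) = (\<integral>\<^sup>+t. ennreal (R powr x * exp (- (R + 1))) * indicator {R..R+1} t \<partial>lborel)"
    by (simp add: nn_integral_cmult_indicator)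
  also have "\<dots> \<le> (\<integral>\<^sup>+t. ennreal (indicator {0..} t * t powr (x + 1 - 1) / exp t) \<partial>lborel)"
  proof (intro nn_integral_mono)
    fix t :: real
    show "ennreal (R powr x * exp (- (R + 1))) * indicator {R..R+1} t
        \<le> ennreal (indicator {0..} t * t powr (x + 1 - 1) / exp t)"
    proof (cases "t \<in> {R..R+1}")
      case True
      then have "R powr x * exp (- (R + 1)) \<le> t powr x * exp (- t)"
        using assms by (intro mult_mono powr_mono2) auto
      then show ?thesis using True assms by (simp add: exp_minus field_simps)
    qed simp
  qed
  also have "\<dots> = ennreal (Gamma (x + 1))"
    using Gamma_conv_nn_integral_real[of "x + 1"] assms by simp
  finally show ?thesis using Gamma_real_pos[of "x + 1"] assms by (simp add: less_imp_le)
qed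

text \<open>All terms are nonnegative and the first is \<open>1\<close>. Convergence matters, as the sum of a divergent series
  is unspecified.\<close>
lemma mittag_leffler_ge_1:
  fixes \<beta> z :: real
  assumes "0 < \<beta>" "0 \<le> z"
  shows "1 \<le> mittag_leffler \<beta> z"
proof -
  let ?a = "\<lambda>k. z ^ k / Gamma (real k * \<beta> + 1)"
  \<comment> \<open>then \<open>R powr \<beta> = 2 * z + 1\<close>, and the terms decay at least like powers of \<open>1/2\<close>\<close>
  define R where "R = (2 * z + 1) powr (1 / \<beta>)"
  have R: "0 < R" "R powr \<beta> = 2 * z + 1" using assms by (auto simp: R_def powr_powr)
  have Gpos: "0 < Gamma (real k * \<beta> + 1)" for k using assms by (intro Gamma_real_pos) (simp add: add_nonneg_pos)
  have bound: "?a k \<le> exp (R + 1) * (1 / 2) ^ k" for k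
  proof -
    have "(2 * z + 1) ^ k * exp (- (R + 1)) = R powr (real k * \<beta>) * exp (- (R + 1))"
      using R assms by (simp add: mult.commute[of "real k"] powr_realpow flip: powr_powr)
    also have "\<dots> \<le> Gamma (real k * \<beta> + 1)" using assms R by (intro Gamma_ge_powr) auto
    finally have "?a k \<le> z ^ k / ((2 * z + 1) ^ k * exp (- (R + 1)))"
      using assms Gpos by (intro divide_left_mono) auto
    also have "\<dots> = exp (R + 1) * (z / (2 * z + 1)) ^ k"
      unfolding exp_minus power_divide by (simp add: divide_inverse mult_ac)
    also have "\<dots> \<le> exp (R + 1) * (1 / 2) ^ k"
      using assms by (intro mult_left_mono power_mono) (auto simp: field_simps)
    finally show ?thesis .
  qed
  have "summable ?a"
  proof (rule summable_comparison_test')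
    show "summable (\<lambda>k. exp (R + 1) * (1 / 2 :: real) ^ k)" by (intro summable_mult summable_geometric) simp
    show "norm (?a k) \<le> exp (R + 1) * (1 / 2) ^ k" for k
      using bound[of k] Gpos[of k] assms by simp
  qed
  then have "sum ?a {..<1} \<le> (\<Sum>k. ?a k)"
    using Gpos assms by (intro sum_le_suminf) (auto intro!: divide_nonneg_pos)
  then show ?thesis by (simp add: mittag_leffler_def)
qed

section \<open>Covariance of weighted Brownian increments\<close>

text \<open>The length of the intersection of \<open>{a<..b}\<close> and \<open>{c<..d}\<close>, provided \<open>a \<le> b\<close> and \<open>c \<le> d\<close>.\<close>
definition overlap :: "real \<Rightarrow> real \<Rightarrow> real \<Rightarrow> real \<Rightarrow> real" where
  "overlap a b c d = max 0 (min b d - max a c)"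

context brownian_motion
begin

lemma measurable_from_filtration:
  assumes "t \<in> {0..T}" "Z \<in> borel_measurable (F t)"
  shows "Z \<in> borel_measurable M"
  using measurable_from_subalg[OF sub[OF assms(1)] assms(2)] .

lemma measurable_filtration_mono:
  assumes "s \<le> t" "Z \<in> borel_measurable (F s)"
  shows "Z \<in> borel_measurable (F t)"
proof -
  have "subalgebra (F t) (F s)"
    using sets_F_mono[OF assms(1)] by (auto simp: subalgebra_def space_F)
  from measurable_from_subalg[OF this assms(2)] show ?thesis .
qed

lemma increment_measurable:
  assumes "0 \<le> a" "a \<le> b" "b \<le> T"
  shows "(\<lambda>\<omega>. B b \<omega> - B a \<omega>) \<in> borel_measurable (F b)"
  using assms adapted[of b] measurable_filtration_mono[OF assms(2) adapted[of a]] by auto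

lemma increment_moments:
  assumes "0 \<le> a" "a \<le> b" "b \<le> T"
  shows "integrable M (\<lambda>\<omega>. B b \<omega> - B a \<omega>)"
    and "integrable M (\<lambda>\<omega>. (B b \<omega> - B a \<omega>)\<^sup>2)"
    and "(\<integral>\<omega>. B b \<omega> - B a \<omega> \<partial>M) = 0"
    and "(\<integral>\<omega>. (B b \<omega> - B a \<omega>)\<^sup>2 \<partial>M) = b - a"
proof -
  consider "a = b" | "a < b" using assms by linarith
  then have "integrable M (\<lambda>\<omega>. B b \<omega> - B a \<omega>) \<and>
     integrable M (\<lambda>\<omega>. (B b \<omega> - B a \<omega>)\<^sup>2) \<and>
     (\<integral>\<omega>. B b \<omega> - B a \<omega> \<partial>M) = 0 \<and> (\<integral>\<omega>. (B b \<omega> - B a \<omega>)\<^sup>2 \<partial>M) = b - a"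
  proof cases
    case 2
    define \<sigma> where "\<sigma> = sqrt (b - a)"
    have \<sigma>: "0 < \<sigma>" using 2 by (simp add: \<sigma>_def)
    have D: "distributed M lborel (\<lambda>\<omega>. B b \<omega> - B a \<omega>) (normal_density 0 \<sigma>)"
      unfolding \<sigma>_def using gaussian_increments assms 2 by auto
    have "integrable M (\<lambda>\<omega>. B b \<omega> - B a \<omega>)"
      using distributed_integrable[OF D, of "\<lambda>x. x"] integrable_normal_moment[OF \<sigma>, of 0 1] by simp
    moreover have "integrable M (\<lambda>\<omega>. (B b \<omega> - B a \<omega>)\<^sup>2)"
      using distributed_integrable[OF D, of "\<lambda>x. x\<^sup>2"] integrable_normal_moment[OF \<sigma>, of 0 2] by simp
    moreover have "(\<integral>\<omega>. B b \<omega> - B a \<omega> \<partial>M) = 0"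
      using distributed_integral[OF D, of "\<lambda>x. x"] integral_normal_moment_nz_1[OF \<sigma>, of 0] by simp
    moreover have "(\<integral>\<omega>. (B b \<omega> - B a \<omega>)\<^sup>2 \<partial>M) = b - a"
      using distributed_integral[OF D, of "\<lambda>x. x\<^sup>2"] integral_normal_moment_even[OF \<sigma>, of 0 1] 2
      by (simp add: \<sigma>_def fact_numeral)
    ultimately show ?thesis by blast
  qed simp
  then show "integrable M (\<lambda>\<omega>. B b \<omega> - B a \<omega>)"
    and "integrable M (\<lambda>\<omega>. (B b \<omega> - B a \<omega>)\<^sup>2)"
    and "(\<integral>\<omega>. B b \<omega> - B a \<omega> \<partial>M) = 0"
    and "(\<integral>\<omega>. (B b \<omega> - B a \<omega>)\<^sup>2 \<partial>M) = b - a" by auto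
qed

lemma indep_var_past_increment:
  assumes "0 \<le> a" "a < b" "b \<le> T" "Z \<in> borel_measurable (F a)"
  shows "indep_var borel Z borel (\<lambda>\<omega>. B b \<omega> - B a \<omega>)"
proof -
  let ?D = "\<lambda>\<omega>. B b \<omega> - B a \<omega>"
  have sp: "space (F a) = space M" by (rule space_F)
  have a: "a \<in> {0..T}" and b: "b \<in> {0..T}" using assms by auto
  have Zm: "Z \<in> borel_measurable M" using measurable_from_filtration[OF a assms(4)] .
  have Dm: "?D \<in> borel_measurable M"
    using measurable_from_filtration[OF b increment_measurable] assms by auto
  have I: "indep_set (sets (F a)) (sets (vimage_algebra (space M) ?D borel))"
    using indep_increments assms by auto
  have 1: "sigma_sets (space M) {Z -` A \<inter> space M |A. A \<in> sets borel} \<subseteq> sets (F a)"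
    using measurable_sets[OF assms(4)] sp
    by (subst sp[symmetric], intro sets.sigma_sets_subset) auto
  have 2: "sigma_sets (space M) {?D -` A \<inter> space M |A. A \<in> sets borel}
      = sets (vimage_algebra (space M) ?D borel)"
    by (simp add: sets_vimage_algebra)
  have "indep_set (sigma_sets (space M) {Z -` A \<inter> space M |A. A \<in> sets borel})
     (sigma_sets (space M) {?D -` A \<inter> space M |A. A \<in> sets borel})"
    using I 1 unfolding 2 indep_sets2_eq by blast
  then show ?thesis unfolding indep_var_eq using Zm Dm by blast
qed

text \<open>An increment is independent of what is known at its start.\<close>
lemma expectation_past_times_increment:
  assumes "0 \<le> a" "a \<le> b" "b \<le> T" "Z \<in> borel_measurable (F a)" "integrable M Z"
  shows "integrable M (\<lambda>\<omega>. Z \<omega> * (B b \<omega> - B a \<omega>))"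
    and "(\<integral>\<omega>. Z \<omega> * (B b \<omega> - B a \<omega>) \<partial>M) = 0"
    and "integrable M (\<lambda>\<omega>. Z \<omega> * (B b \<omega> - B a \<omega>)\<^sup>2)"
    and "(\<integral>\<omega>. Z \<omega> * (B b \<omega> - B a \<omega>)\<^sup>2 \<partial>M) = (\<integral>\<omega>. Z \<omega> \<partial>M) * (b - a)"
proof -
  let ?D = "\<lambda>\<omega>. B b \<omega> - B a \<omega>"
  have "integrable M (\<lambda>\<omega>. Z \<omega> * ?D \<omega>) \<and> (\<integral>\<omega>. Z \<omega> * ?D \<omega> \<partial>M) = 0 \<and>
      integrable M (\<lambda>\<omega>. Z \<omega> * (?D \<omega>)\<^sup>2) \<and> (\<integral>\<omega>. Z \<omega> * (?D \<omega>)\<^sup>2 \<partial>M) = (\<integral>\<omega>. Z \<omega> \<partial>M) * (b - a)"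
  proof (cases "a = b")
    case False
    then have ind: "indep_var borel Z borel ?D"
      using assms by (intro indep_var_past_increment) auto
    have ind2: "indep_var borel Z borel (\<lambda>\<omega>. (?D \<omega>)\<^sup>2)"
      using indep_var_compose[OF ind, of "\<lambda>x. x" borel "\<lambda>x. x\<^sup>2" borel] by (simp add: comp_def)
    note m = increment_moments[OF assms(1-3)]
    show ?thesis
      using indep_var_integrable[OF ind assms(5) m(1)] indep_var_lebesgue_integral[OF ind assms(5) m(1)]
        indep_var_integrable[OF ind2 assms(5) m(2)] indep_var_lebesgue_integral[OF ind2 assms(5) m(2)] m(3,4)
      by simp
  qed simp
  then show "integrable M (\<lambda>\<omega>. Z \<omega> * (B b \<omega> - B a \<omega>))"
    and "(\<integral>\<omega>. Z \<omega> * (B b \<omega> - B a \<omega>) \<partial>M) = 0"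
    and "integrable M (\<lambda>\<omega>. Z \<omega> * (B b \<omega> - B a \<omega>)\<^sup>2)"
    and "(\<integral>\<omega>. Z \<omega> * (B b \<omega> - B a \<omega>)\<^sup>2 \<partial>M) = (\<integral>\<omega>. Z \<omega> \<partial>M) * (b - a)" by auto
qed

definition elementary_weight :: "real \<Rightarrow> ('a \<Rightarrow> real) \<Rightarrow> bool" where
  "elementary_weight a \<xi> \<longleftrightarrow> \<xi> \<in> borel_measurable (F a) \<and> bounded (\<xi> ` space M)"

lemma elementary_weight_mono: "elementary_weight a \<xi> \<Longrightarrow> a \<le> b \<Longrightarrow> elementary_weight b \<xi>"
  unfolding elementary_weight_def using measurable_filtration_mono by blast

lemma elementary_weight_mult:
  assumes "elementary_weight a \<xi>" "elementary_weight a \<zeta>"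
  shows "elementary_weight a (\<lambda>\<omega>. \<xi> \<omega> * \<zeta> \<omega>)"
proof -
  obtain K where K: "\<And>\<omega>. \<omega> \<in> space M \<Longrightarrow> \<bar>\<xi> \<omega>\<bar> \<le> K"
    using assms(1) unfolding elementary_weight_def bounded_real by auto
  obtain L where L: "\<And>\<omega>. \<omega> \<in> space M \<Longrightarrow> \<bar>\<zeta> \<omega>\<bar> \<le> L"
    using assms(2) unfolding elementary_weight_def bounded_real by auto
  have "bounded ((\<lambda>\<omega>. \<xi> \<omega> * \<zeta> \<omega>) ` space M)"
    unfolding bounded_real
    by (rule exI[of _ "K * L"])
       (use K L in \<open>auto simp: abs_mult intro!: mult_mono order_trans[OF abs_ge_zero]\<close>)
  then show ?thesis using assms unfolding elementary_weight_def by auto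
qed

lemma elementary_weight_integrable_mult:
  assumes "elementary_weight a \<xi>" "a \<in> {0..T}" "integrable M Z"
  shows "integrable M (\<lambda>\<omega>. \<xi> \<omega> * Z \<omega>)"
proof -
  obtain K where K: "\<And>\<omega>. \<omega> \<in> space M \<Longrightarrow> \<bar>\<xi> \<omega>\<bar> \<le> K"
    using assms(1) unfolding elementary_weight_def bounded_real by auto
  have [measurable]: "\<xi> \<in> borel_measurable M"
    using assms measurable_from_filtration unfolding elementary_weight_def by blast
  have [measurable]: "Z \<in> borel_measurable M" using assms by auto
  show ?thesis
  proof (rule Bochner_Integration.integrable_bound[where f="\<lambda>\<omega>. K * Z \<omega>"])
    show "AE \<omega> in M. norm (\<xi> \<omega> * Z \<omega>) \<le> norm (K * Z \<omega>)"
      using K by (intro AE_I2) (simp add: abs_mult mult_right_mono order_trans[OF _ abs_ge_self])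
  qed (use assms in auto)
qed

lemma elementary_weight_integrable:
  "elementary_weight a \<xi> \<Longrightarrow> a \<in> {0..T} \<Longrightarrow> integrable M \<xi>"
  using elementary_weight_integrable_mult[of a \<xi> "\<lambda>_. 1"] by simp

lemma increments_integrable:
  assumes "0 \<le> a" "a \<le> b" "b \<le> T" "0 \<le> c" "c \<le> d" "d \<le> T"
  shows "integrable M (\<lambda>\<omega>. (B b \<omega> - B a \<omega>) * (B d \<omega> - B c \<omega>))"
proof -
  have [measurable]: "(\<lambda>\<omega>. B b \<omega> - B a \<omega>) \<in> borel_measurable M"
     "(\<lambda>\<omega>. B d \<omega> - B c \<omega>) \<in> borel_measurable M"
    using increment_moments(1)[OF assms(1-3)] increment_moments(1)[OF assms(4-6)] by auto
  show ?thesis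
  proof (rule Bochner_Integration.integrable_bound[where f="\<lambda>\<omega>. (B b \<omega> - B a \<omega>)\<^sup>2 + (B d \<omega> - B c \<omega>)\<^sup>2"])
    have "\<bar>x * y\<bar> \<le> \<bar>x\<^sup>2 + y\<^sup>2\<bar>" for x y :: real
    proof -
      have "0 \<le> (\<bar>x\<bar> - \<bar>y\<bar>)\<^sup>2" by simp
      then have "2 * \<bar>x * y\<bar> \<le> x\<^sup>2 + y\<^sup>2" by (simp add: power2_diff abs_mult)
      then show ?thesis by simp
    qed
    then show "AE \<omega> in M. norm ((B b \<omega> - B a \<omega>) * (B d \<omega> - B c \<omega>))
       \<le> norm ((B b \<omega> - B a \<omega>)\<^sup>2 + (B d \<omega> - B c \<omega>)\<^sup>2)" by simp
  qed (use increment_moments[OF assms(1-3)] increment_moments[OF assms(4-6)] in auto)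
qed

lemma product_integrable:
  assumes "0 \<le> a" "a \<le> b" "b \<le> T" "0 \<le> c" "c \<le> d" "d \<le> T"
    and "elementary_weight a \<xi>" "elementary_weight c \<zeta>"
  shows "integrable M (\<lambda>\<omega>. \<xi> \<omega> * (B b \<omega> - B a \<omega>) * (\<zeta> \<omega> * (B d \<omega> - B c \<omega>)))"
proof -
  have "elementary_weight (max a c) (\<lambda>\<omega>. \<xi> \<omega> * \<zeta> \<omega>)"
    using assms by (intro elementary_weight_mult) (auto elim!: elementary_weight_mono)
  from elementary_weight_integrable_mult[OF this _ increments_integrable[OF assms(1-6)]] assms
  show ?thesis by (simp add: ac_simps)
qed

text \<open>The weight and the earlier increment are both known when the later increment starts.\<close>
lemma expectation_disjoint_increments:
  assumes "0 \<le> a" "a \<le> b" "b \<le> c" "c \<le> d" "d \<le> T" "elementary_weight c \<zeta>"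
  shows "(\<integral>\<omega>. \<zeta> \<omega> * ((B b \<omega> - B a \<omega>) * (B d \<omega> - B c \<omega>)) \<partial>M) = 0"
proof -
  have m: "(\<lambda>\<omega>. \<zeta> \<omega> * (B b \<omega> - B a \<omega>)) \<in> borel_measurable (F c)"
    using assms measurable_filtration_mono[OF _ increment_measurable[of a b], of c]
    unfolding elementary_weight_def by auto
  have "integrable M (\<lambda>\<omega>. \<zeta> \<omega> * (B b \<omega> - B a \<omega>))"
    using assms by (intro elementary_weight_integrable_mult increment_moments) auto
  from expectation_past_times_increment(2)[OF _ _ _ m this, of d] assms show ?thesis
    by (simp add: ac_simps)
qed

text \<open>The longer increment is the shorter one plus an increment that starts where the shorter one ends.
  The first part contributes a variance, the second one nothing.\<close>
lemma expectation_common_start: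
  assumes "0 \<le> c" "c \<le> b" "b \<le> d" "d \<le> T" "elementary_weight c \<zeta>"
  shows "(\<integral>\<omega>. \<zeta> \<omega> * ((B b \<omega> - B c \<omega>) * (B d \<omega> - B c \<omega>)) \<partial>M) = (\<integral>\<omega>. \<zeta> \<omega> \<partial>M) * (b - c)"
proof -
  have c: "c \<in> {0..T}" using assms by auto
  have Zi: "integrable M \<zeta>" using elementary_weight_integrable[OF assms(5) c] .
  have Zm: "\<zeta> \<in> borel_measurable (F c)" using assms unfolding elementary_weight_def by auto
  note sq = expectation_past_times_increment[OF assms(1,2) _ Zm Zi]
  have i2: "integrable M (\<lambda>\<omega>. \<zeta> \<omega> * ((B b \<omega> - B c \<omega>) * (B d \<omega> - B b \<omega>)))"
    using assms by (intro elementary_weight_integrable_mult[OF _ c] increments_integrable) auto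
  have "(\<integral>\<omega>. \<zeta> \<omega> * ((B b \<omega> - B c \<omega>) * (B d \<omega> - B c \<omega>)) \<partial>M)
     = (\<integral>\<omega>. \<zeta> \<omega> * (B b \<omega> - B c \<omega>)\<^sup>2 + \<zeta> \<omega> * ((B b \<omega> - B c \<omega>) * (B d \<omega> - B b \<omega>)) \<partial>M)"
    by (intro Bochner_Integration.integral_cong) (auto simp: power2_eq_square algebra_simps)
  also have "\<dots> = (\<integral>\<omega>. \<zeta> \<omega> * (B b \<omega> - B c \<omega>)\<^sup>2 \<partial>M) + (\<integral>\<omega>. \<zeta> \<omega> * ((B b \<omega> - B c \<omega>) * (B d \<omega> - B b \<omega>)) \<partial>M)"
    using assms by (intro Bochner_Integration.integral_add i2 sq) auto
  also have "(\<integral>\<omega>. \<zeta> \<omega> * ((B b \<omega> - B c \<omega>) * (B d \<omega> - B b \<omega>)) \<partial>M) = 0"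
    using assms by (intro expectation_disjoint_increments elementary_weight_mono[OF assms(5)]) auto
  finally show ?thesis using sq(4) assms by simp
qed

text \<open>Splitting the earlier interval at \<open>c\<close> reduces overlapping intervals to disjoint intervals and intervals
  with a common start.\<close>
lemma elementary_covariance_ordered:
  assumes "0 \<le> a" "a \<le> b" "b \<le> T" "c \<le> d" "d \<le> T" "a \<le> c"
    and "elementary_weight c \<zeta>"
  shows "(\<integral>\<omega>. \<zeta> \<omega> * ((B b \<omega> - B a \<omega>) * (B d \<omega> - B c \<omega>)) \<partial>M)
    = (\<integral>\<omega>. \<zeta> \<omega> \<partial>M) * overlap a b c d"
proof (cases "b \<le> c")
  case True
  then show ?thesis
    using expectation_disjoint_increments[OF assms(1,2) True assms(4,5,7)] by (simp add: overlap_def)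
next
  case False
  have c: "c \<in> {0..T}" using assms by auto
  have i: "integrable M (\<lambda>\<omega>. \<zeta> \<omega> * ((B c \<omega> - B a \<omega>) * (B d \<omega> - B c \<omega>)))"
       "integrable M (\<lambda>\<omega>. \<zeta> \<omega> * ((B b \<omega> - B c \<omega>) * (B d \<omega> - B c \<omega>)))"
    using assms False
    by (intro elementary_weight_integrable_mult[OF assms(7) c] increments_integrable; simp)+
  have "(\<integral>\<omega>. \<zeta> \<omega> * ((B b \<omega> - B a \<omega>) * (B d \<omega> - B c \<omega>)) \<partial>M)
     = (\<integral>\<omega>. \<zeta> \<omega> * ((B c \<omega> - B a \<omega>) * (B d \<omega> - B c \<omega>)) + \<zeta> \<omega> * ((B b \<omega> - B c \<omega>) * (B d \<omega> - B c \<omega>)) \<partial>M)"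
    by (intro Bochner_Integration.integral_cong) (auto simp: algebra_simps)
  also have "\<dots> = (\<integral>\<omega>. \<zeta> \<omega> * ((B b \<omega> - B c \<omega>) * (B d \<omega> - B c \<omega>)) \<partial>M)"
    using expectation_disjoint_increments[of a c c d \<zeta>] assms c
    by (subst Bochner_Integration.integral_add[OF i]) auto
  also have "\<dots> = (\<integral>\<omega>. \<zeta> \<omega> \<partial>M) * (min b d - c)"
  proof (cases "b \<le> d")
    case True
    then show ?thesis using expectation_common_start[of c b d \<zeta>] assms False c by simp
  next
    case F: False
    then show ?thesis using expectation_common_start[of c d b \<zeta>] assms False c
      by (simp add: mult.commute)
  qed
  finally show ?thesis using assms False by (simp add: overlap_def)
qed

lemma elementary_covariance:
  assumes "0 \<le> a" "a \<le> b" "b \<le> T" "0 \<le> c" "c \<le> d" "d \<le> T"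
    and "elementary_weight a \<xi>" "elementary_weight c \<zeta>"
  shows "(\<integral>\<omega>. \<xi> \<omega> * (B b \<omega> - B a \<omega>) * (\<zeta> \<omega> * (B d \<omega> - B c \<omega>)) \<partial>M)
    = (\<integral>\<omega>. \<xi> \<omega> * \<zeta> \<omega> \<partial>M) * overlap a b c d"
proof (cases "a \<le> c")
  case True
  have "elementary_weight c (\<lambda>\<omega>. \<xi> \<omega> * \<zeta> \<omega>)"
    using assms True by (intro elementary_weight_mult) (auto elim!: elementary_weight_mono)
  from elementary_covariance_ordered[OF assms(1-3,5,6) True this] show ?thesis
    by (simp add: ac_simps)
next
  case False
  then have le: "c \<le> a" by simp
  have "elementary_weight a (\<lambda>\<omega>. \<zeta> \<omega> * \<xi> \<omega>)"
    using assms le by (intro elementary_weight_mult) (auto elim!: elementary_weight_mono)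
  from elementary_covariance_ordered[OF assms(4-6,2,3) le this] show ?thesis
    by (simp add: ac_simps overlap_def)
qed

end

lemma lborel_overlap:
  "integrable lborel (\<lambda>s. indicator {a<..b} s * indicator {c<..d} s :: real)"
  "(\<integral>s. indicator {a<..b} s * indicator {c<..d} s \<partial>lborel) = overlap a b c d"
proof -
  have *: "(\<lambda>s. indicator {a<..b} s * indicator {c<..d} s :: real) = indicator {max a c<..min b d}"
    by (rule ext) (simp add: indicator_def)
  show "integrable lborel (\<lambda>s. indicator {a<..b} s * indicator {c<..d} s :: real)"
    unfolding * by (cases "max a c \<le> min b d") (auto intro!: integrable_real_indicator)
  show "(\<integral>s. indicator {a<..b} s * indicator {c<..d} s \<partial>lborel) = overlap a b c d"
    unfolding * overlap_def by (cases "max a c \<le> min b d") auto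
qed

section \<open>The Ito isometry\<close>

context brownian_motion
begin

text \<open>Expanding the squares, both sides become sums over pairs of intervals of the expected product of
  the weights times the overlap. The intervals may overlap in any way, so a difference of two such
  sums is again one of them.\<close>
lemma elementary_isometry:
  fixes I :: "'i set" and a b :: "'i \<Rightarrow> real" and \<xi> :: "'i \<Rightarrow> 'a \<Rightarrow> real"
  assumes I: "finite I" "\<And>i. i \<in> I \<Longrightarrow> 0 \<le> a i" "\<And>i. i \<in> I \<Longrightarrow> a i \<le> b i" "\<And>i. i \<in> I \<Longrightarrow> b i \<le> T"
    and \<xi>: "\<And>i. i \<in> I \<Longrightarrow> elementary_weight (a i) (\<xi> i)"
  shows "(\<integral>\<^sup>+\<omega>. ennreal ((\<Sum>i\<in>I. \<xi> i \<omega> * (B (b i) \<omega> - B (a i) \<omega>))\<^sup>2) \<partial>M)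
    = (\<integral>\<^sup>+(s, \<omega>). ennreal ((\<Sum>i\<in>I. \<xi> i \<omega> * indicator {a i<..b i} s)\<^sup>2) \<partial>(lborel \<Otimes>\<^sub>M M))"
proof -
  interpret pair_sigma_finite lborel M ..
  let ?ov = "\<lambda>i j. overlap (a i) (b i) (a j) (b j)"
  have aT: "a i \<in> {0..T}" if "i \<in> I" for i using I(2-4)[OF that] by auto
  have [measurable]: "\<xi> i \<in> borel_measurable M" if "i \<in> I" for i
    using \<xi>[OF that] measurable_from_filtration[OF aT[OF that]] unfolding elementary_weight_def by auto
  have prod_int: "integrable M (\<lambda>\<omega>. \<xi> i \<omega> * \<xi> j \<omega>)" if "i \<in> I" "j \<in> I" for i j
    by (rule elementary_weight_integrable_mult[OF \<xi>[OF that(1)] aT[OF that(1)]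
          elementary_weight_integrable[OF \<xi>[OF that(2)] aT[OF that(2)]]])
  have cross: "integrable M (\<lambda>\<omega>. \<xi> i \<omega> * (B (b i) \<omega> - B (a i) \<omega>) * (\<xi> j \<omega> * (B (b j) \<omega> - B (a j) \<omega>)))"
    if "i \<in> I" "j \<in> I" for i j
    using that I \<xi> by (intro product_integrable) auto
  have sq: "(\<Sum>i\<in>I. f i)\<^sup>2 = (\<Sum>i\<in>I. \<Sum>j\<in>I. f i * f j)" for f :: "'i \<Rightarrow> real"
    by (simp add: power2_eq_square sum_product)
  have inner: "integrable lborel (\<lambda>s. (\<Sum>i\<in>I. \<xi> i \<omega> * indicator {a i<..b i} s)\<^sup>2)"
    "(\<integral>s. (\<Sum>i\<in>I. \<xi> i \<omega> * indicator {a i<..b i} s)\<^sup>2 \<partial>lborel)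
      = (\<Sum>i\<in>I. \<Sum>j\<in>I. \<xi> i \<omega> * \<xi> j \<omega> * ?ov i j)" for \<omega>
  proof -
    have e: "\<xi> i \<omega> * indicator {a i<..b i} s * (\<xi> j \<omega> * indicator {a j<..b j} s)
       = (\<xi> i \<omega> * \<xi> j \<omega>) * (indicator {a i<..b i} s * indicator {a j<..b j} s)" for i j s
      by simp
    show "integrable lborel (\<lambda>s. (\<Sum>i\<in>I. \<xi> i \<omega> * indicator {a i<..b i} s)\<^sup>2)"
      unfolding sq e by (intro Bochner_Integration.integrable_sum integrable_mult_right lborel_overlap)
    show "(\<integral>s. (\<Sum>i\<in>I. \<xi> i \<omega> * indicator {a i<..b i} s)\<^sup>2 \<partial>lborel)
      = (\<Sum>i\<in>I. \<Sum>j\<in>I. \<xi> i \<omega> * \<xi> j \<omega> * ?ov i j)"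
      unfolding sq e using lborel_overlap by (simp add: Bochner_Integration.integral_sum)
  qed
  have "(\<integral>\<^sup>+\<omega>. ennreal ((\<Sum>i\<in>I. \<xi> i \<omega> * (B (b i) \<omega> - B (a i) \<omega>))\<^sup>2) \<partial>M)
     = ennreal (\<integral>\<omega>. (\<Sum>i\<in>I. \<xi> i \<omega> * (B (b i) \<omega> - B (a i) \<omega>))\<^sup>2 \<partial>M)"
    unfolding sq using cross
    by (intro nn_integral_eq_integral Bochner_Integration.integrable_sum) (auto simp flip: sq)
  also have "(\<integral>\<omega>. (\<Sum>i\<in>I. \<xi> i \<omega> * (B (b i) \<omega> - B (a i) \<omega>))\<^sup>2 \<partial>M)
     = (\<Sum>i\<in>I. \<Sum>j\<in>I. (\<integral>\<omega>. \<xi> i \<omega> * \<xi> j \<omega> \<partial>M) * ?ov i j)"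
    unfolding sq using cross I \<xi>
    by (simp add: Bochner_Integration.integral_sum elementary_covariance)
  also have "\<dots> = (\<integral>\<omega>. (\<Sum>i\<in>I. \<Sum>j\<in>I. \<xi> i \<omega> * \<xi> j \<omega> * ?ov i j) \<partial>M)"
    using prod_int by (simp add: Bochner_Integration.integral_sum)
  also have "ennreal \<dots> = (\<integral>\<^sup>+\<omega>. ennreal (\<Sum>i\<in>I. \<Sum>j\<in>I. \<xi> i \<omega> * \<xi> j \<omega> * ?ov i j) \<partial>M)"
    by (intro nn_integral_eq_integral[symmetric] Bochner_Integration.integrable_sum
        integrable_mult_left prod_int AE_I2) (simp_all flip: inner(2))
  also have "\<dots> = (\<integral>\<^sup>+\<omega>. \<integral>\<^sup>+s. ennreal ((\<Sum>i\<in>I. \<xi> i \<omega> * indicator {a i<..b i} s)\<^sup>2) \<partial>lborel \<partial>M)"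
    by (intro nn_integral_cong) (simp add: nn_integral_eq_integral inner)
  also have "\<dots> = (\<integral>\<^sup>+(s, \<omega>). ennreal ((\<Sum>i\<in>I. \<xi> i \<omega> * indicator {a i<..b i} s)\<^sup>2) \<partial>(lborel \<Otimes>\<^sub>M M))"
    by (subst nn_integral_snd[symmetric]) simp_all
  finally show ?thesis .
qed

lemma simple_integrand_bounds:
  assumes "simple_integrand F t n \<tau> \<xi>" "i \<le> n"
  shows "0 \<le> \<tau> i" "\<tau> i \<le> t"
proof -
  have step: "\<tau> i \<le> \<tau> (Suc i)" if "i < n" for i
    using assms(1) that unfolding simple_integrand_def by auto
  have "\<tau> i \<le> \<tau> j" if "i \<le> j" "j \<le> n" for i j
    using that
  proof (induction j rule: dec_induct)
    case (step m)
    then show ?case using \<open>\<And>i. i < n \<Longrightarrow> \<tau> i \<le> \<tau> (Suc i)\<close>[of m] by simp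
  qed simp
  from this[of 0 i] this[of i n] assms show "0 \<le> \<tau> i" "\<tau> i \<le> t"
    unfolding simple_integrand_def by auto
qed

lemma simple_integrand_weight:
  assumes "simple_integrand F t n \<tau> \<xi>" "i < n"
  shows "elementary_weight (\<tau> i) (\<xi> i)" "\<tau> i \<le> \<tau> (Suc i)"
  using assms unfolding simple_integrand_def elementary_weight_def by (auto simp: space_F)

text \<open>Both processes together form one elementary family, indexed by a disjoint sum, with the weights of
  the second one negated.\<close>
lemma simple_ito_isometry:
  assumes s: "simple_integrand F s n \<tau> \<xi>" "s \<le> T" and t: "simple_integrand F t m \<sigma> \<zeta>" "t \<le> T"
  shows "(\<integral>\<^sup>+\<omega>. ennreal ((simple_ito_integral B n \<tau> \<xi> \<omega> - simple_ito_integral B m \<sigma> \<zeta> \<omega>)\<^sup>2) \<partial>M)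
    = (\<integral>\<^sup>+(u, \<omega>). ennreal ((simple_process n \<tau> \<xi> u \<omega> - simple_process m \<sigma> \<zeta> u \<omega>)\<^sup>2) \<partial>(lborel \<Otimes>\<^sub>M M))"
proof -
  have "0 \<le> case_sum \<tau> \<sigma> i \<and>
       case_sum \<tau> \<sigma> i \<le> case_sum (\<lambda>i. \<tau> (Suc i)) (\<lambda>i. \<sigma> (Suc i)) i \<and>
       case_sum (\<lambda>i. \<tau> (Suc i)) (\<lambda>i. \<sigma> (Suc i)) i \<le> T \<and>
       elementary_weight (case_sum \<tau> \<sigma> i) (case_sum \<xi> (\<lambda>j \<omega>. - \<zeta> j \<omega>) i)"
    if i: "i \<in> {..<n} <+> {..<m}" for i
  proof -
    have neg: "elementary_weight c (\<lambda>\<omega>. - \<zeta> j \<omega>)" if "elementary_weight c (\<zeta> j)" for c j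
      using that unfolding elementary_weight_def bounded_real by auto
    consider (l) j where "i = Inl j" "j < n" | (r) j where "i = Inr j" "j < m"
      using i by auto
    then show ?thesis
    proof cases
      case l
      then show ?thesis
        using simple_integrand_bounds[OF s(1), of j] simple_integrand_bounds[OF s(1), of "Suc j"]
          simple_integrand_weight[OF s(1), of j] s(2) by simp
    next
      case r
      then show ?thesis
        using simple_integrand_bounds[OF t(1), of j] simple_integrand_bounds[OF t(1), of "Suc j"]
          simple_integrand_weight[OF t(1), of j] t(2) neg by simp
    qed
  qed
  then show ?thesis
    using elementary_isometry[of "{..<n} <+> {..<m}" "case_sum \<tau> \<sigma>"
        "case_sum (\<lambda>i. \<tau> (Suc i)) (\<lambda>i. \<sigma> (Suc i))" "case_sum \<xi> (\<lambda>j \<omega>. - \<zeta> j \<omega>)"]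
    by (simp add: sum.Plus sum_negf simple_ito_integral_def simple_process_def case_prod_beta' del: sum_mult_indicator)
qed

end

text \<open>The first factor may be taken as close to \<open>1\<close> as desired, at the expense of the second. This is what
  preserves the exact constant in a limit where \<open>v\<close> tends to \<open>0\<close>.\<close>
lemma nn_integral_add_square_le:
  fixes u v :: "'b \<Rightarrow> real"
  assumes [measurable]: "u \<in> borel_measurable N" "v \<in> borel_measurable N" and "0 < \<epsilon>"
  shows "(\<integral>\<^sup>+x. ennreal ((u x + v x)\<^sup>2) \<partial>N)
     \<le> ennreal (1 + \<epsilon>) * (\<integral>\<^sup>+x. ennreal ((u x)\<^sup>2) \<partial>N) + ennreal (1 + 1/\<epsilon>) * (\<integral>\<^sup>+x. ennreal ((v x)\<^sup>2) \<partial>N)"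
proof -
  have "(x + y)\<^sup>2 \<le> (1 + \<epsilon>) * x\<^sup>2 + (1 + 1/\<epsilon>) * y\<^sup>2" for x y :: real
  proof -
    have "0 \<le> (\<epsilon> * x - y)\<^sup>2 / \<epsilon>" using assms by simp
    also have "\<dots> = \<epsilon> * x\<^sup>2 - 2 * x * y + y\<^sup>2 / \<epsilon>"
      using assms by (simp add: power2_eq_square field_simps)
    finally show ?thesis by (simp add: power2_sum algebra_simps)
  qed
  then have "(\<integral>\<^sup>+x. ennreal ((u x + v x)\<^sup>2) \<partial>N)
     \<le> (\<integral>\<^sup>+x. ennreal (1 + \<epsilon>) * ennreal ((u x)\<^sup>2) + ennreal (1 + 1/\<epsilon>) * ennreal ((v x)\<^sup>2) \<partial>N)"
    using assms by (intro nn_integral_mono) (simp flip: ennreal_mult ennreal_plus)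
  also have "\<dots> = ennreal (1 + \<epsilon>) * (\<integral>\<^sup>+x. ennreal ((u x)\<^sup>2) \<partial>N) + ennreal (1 + 1/\<epsilon>) * (\<integral>\<^sup>+x. ennreal ((v x)\<^sup>2) \<partial>N)"
    by (subst nn_integral_add) (auto simp: nn_integral_cmult)
  finally show ?thesis .
qed

text \<open>Equality of norms along approximating sequences passes to the limit, even between different measure
  spaces. Exchanging the roles of \<open>u\<close> and \<open>v\<close> gives equality.\<close>
lemma L2_limit_le:
  fixes u :: "'b \<Rightarrow> real" and v :: "'c \<Rightarrow> real"
  assumes [measurable]: "u \<in> borel_measurable N" "\<And>k. uu k \<in> borel_measurable N"
    "v \<in> borel_measurable N'" "\<And>k. vv k \<in> borel_measurable N'"
    and u: "(\<lambda>k. \<integral>\<^sup>+x. ennreal ((u x - uu k x)\<^sup>2) \<partial>N) \<longlonglongrightarrow> 0"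
    and v: "(\<lambda>k. \<integral>\<^sup>+x. ennreal ((v x - vv k x)\<^sup>2) \<partial>N') \<longlonglongrightarrow> 0"
    and eq: "\<And>k. (\<integral>\<^sup>+x. ennreal ((uu k x)\<^sup>2) \<partial>N) = (\<integral>\<^sup>+x. ennreal ((vv k x)\<^sup>2) \<partial>N')"
  shows "(\<integral>\<^sup>+x. ennreal ((u x)\<^sup>2) \<partial>N) \<le> (\<integral>\<^sup>+x. ennreal ((v x)\<^sup>2) \<partial>N')"
proof -
  let ?U = "\<integral>\<^sup>+x. ennreal ((u x)\<^sup>2) \<partial>N" and ?V = "\<integral>\<^sup>+x. ennreal ((v x)\<^sup>2) \<partial>N'"
  let ?r = "\<lambda>k. \<integral>\<^sup>+x. ennreal ((u x - uu k x)\<^sup>2) \<partial>N" and ?s = "\<lambda>k. \<integral>\<^sup>+x. ennreal ((v x - vv k x)\<^sup>2) \<partial>N'"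
  have eps: "?U \<le> ennreal (1 + \<epsilon>) * (ennreal (1 + \<epsilon>) * ?V)" if "0 < \<epsilon>" for \<epsilon>
  proof -
    let ?e = "ennreal (1 + \<epsilon>)" and ?d = "ennreal (1 + 1/\<epsilon>)"
    have "?U \<le> ?e * (?e * ?V + ?d * ?s k) + ?d * ?r k" for k
    proof -
      have "?U \<le> ?e * (\<integral>\<^sup>+x. ennreal ((uu k x)\<^sup>2) \<partial>N) + ?d * ?r k"
        using nn_integral_add_square_le[of "uu k" N "\<lambda>x. u x - uu k x" \<epsilon>] that by simp
      also have "(\<integral>\<^sup>+x. ennreal ((uu k x)\<^sup>2) \<partial>N) \<le> ?e * ?V + ?d * ?s k"
        using nn_integral_add_square_le[of v N' "\<lambda>x. vv k x - v x" \<epsilon>] that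
        by (simp add: eq power2_commute)
      finally show ?thesis by (simp add: mult_left_mono add_right_mono)
    qed
    moreover have "(\<lambda>k. ?e * (?e * ?V + ?d * ?s k) + ?d * ?r k) \<longlonglongrightarrow> ?e * (?e * ?V + ?d * 0) + ?d * 0"
      by (intro tendsto_add tendsto_const ennreal_tendsto_cmult u v) auto
    ultimately show ?thesis
      using LIMSEQ_le_const by (metis (no_types, lifting) add.right_neutral mult_zero_right)
  qed
  show ?thesis
  proof (cases "?V = \<top>")
    case False
    have "(\<lambda>n. ennreal (1 + inverse (real (Suc n))) * (ennreal (1 + inverse (real (Suc n))) * ?V))
        \<longlonglongrightarrow> ennreal (1 + 0) * (ennreal (1 + 0) * ?V)"
      using False by (intro tendsto_mult_ennreal tendsto_ennrealI tendsto_add tendsto_const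
          LIMSEQ_inverse_real_of_nat) auto
    from LIMSEQ_le_const[OF this] eps show ?thesis by simp
  qed simp
qed

lemma measurable_time_space_extend:
  fixes f :: "real \<times> 'a \<Rightarrow> 'b :: {topological_space, zero}"
  assumes "f \<in> borel_measurable (time_space M t)"
  shows "(\<lambda>x. if fst x \<in> {0..t} then f x else 0) \<in> borel_measurable (lborel \<Otimes>\<^sub>M M)"
proof (subst measurable_If_restrict_space_iff)
  have "(\<lambda>x. x) \<in> restrict_space (lborel \<Otimes>\<^sub>M M) {x. fst x \<in> {0..t}} \<rightarrow>\<^sub>M time_space M t"
  proof (rule measurable_pair)
    show "fst \<circ> (\<lambda>x. x) \<in> restrict_space (lborel \<Otimes>\<^sub>M M) {x. fst x \<in> {0..t}} \<rightarrow>\<^sub>M restrict_space lborel {0..t}"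
      by (rule measurable_restrict_space2)
         (auto simp: comp_def space_restrict_space intro!: measurable_restrict_space1)
    show "snd \<circ> (\<lambda>x. x) \<in> restrict_space (lborel \<Otimes>\<^sub>M M) {x. fst x \<in> {0..t}} \<rightarrow>\<^sub>M M"
      by (auto simp: comp_def intro!: measurable_restrict_space1)
  qed
  from measurable_compose[OF this assms]
  show "f \<in> borel_measurable (restrict_space (lborel \<Otimes>\<^sub>M M) {x. fst x \<in> {0..t}}) \<and>
    (\<lambda>x. 0) \<in> borel_measurable (restrict_space (lborel \<Otimes>\<^sub>M M) {x. fst x \<notin> {0..t}})" by simp
next
  show "{x \<in> space (lborel \<Otimes>\<^sub>M M). fst x \<in> {0..t}} \<in> sets (lborel \<Otimes>\<^sub>M M)" by measurable
qed

lemma nn_integral_time_space: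
  fixes f :: "real \<times> 'a \<Rightarrow> ennreal"
  assumes "sigma_finite_measure M" "f \<in> borel_measurable (time_space M t)"
  shows "(\<integral>\<^sup>+x. f x \<partial>time_space M t) = (\<integral>\<^sup>+x. (if fst x \<in> {0..t} then f x else 0) \<partial>(lborel \<Otimes>\<^sub>M M))"
proof -
  interpret sigma_finite_measure M by fact
  have "(\<integral>\<^sup>+x. f x \<partial>time_space M t) = (\<integral>\<^sup>+s. \<integral>\<^sup>+\<omega>. f (s, \<omega>) \<partial>M \<partial>restrict_space lborel {0..t})"
    using nn_integral_fst[OF assms(2)] by simp
  also have "\<dots> = (\<integral>\<^sup>+s. \<integral>\<^sup>+\<omega>. (if s \<in> {0..t} then f (s, \<omega>) else 0) \<partial>M \<partial>lborel)"
    by (subst nn_integral_restrict_space) (auto simp: indicator_def intro!: nn_integral_cong)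
  also have "\<dots> = (\<integral>\<^sup>+x. (if fst x \<in> {0..t} then f x else 0) \<partial>(lborel \<Otimes>\<^sub>M M))"
    using nn_integral_fst[OF measurable_time_space_extend[OF assms(2)]] by simp
  finally show ?thesis .
qed

text \<open>Integrands on different intervals \<open>{0..s}\<close> and \<open>{0..t}\<close> become comparable on \<open>lborel \<Otimes>\<^sub>M M\<close>.\<close>
definition extend_by_zero :: "real \<Rightarrow> (real \<Rightarrow> 'a \<Rightarrow> real) \<Rightarrow> real \<times> 'a \<Rightarrow> real" where
  "extend_by_zero t f x = (if fst x \<in> {0..t} then f (fst x) (snd x) else 0)"

context brownian_motion
begin

text \<open>The approximation from the definition of the integral, transported to the whole time axis. Simple
  processes vanish off the interval on their own.\<close>
definition ito_approximation where
  "ito_approximation t f I n \<tau> \<xi> \<longleftrightarrow>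
    (\<forall>k. simple_integrand F t (n k) (\<tau> k) (\<xi> k)) \<and>
    (\<forall>k. (\<lambda>(s, \<omega>). simple_process (n k) (\<tau> k) (\<xi> k) s \<omega>) \<in> borel_measurable (lborel \<Otimes>\<^sub>M M)) \<and>
    (\<forall>k. simple_ito_integral B (n k) (\<tau> k) (\<xi> k) \<in> borel_measurable M) \<and>
    ((\<lambda>k. \<integral>\<^sup>+x. ennreal ((extend_by_zero t f x -
       (case x of (s, \<omega>) \<Rightarrow> simple_process (n k) (\<tau> k) (\<xi> k) s \<omega>))\<^sup>2) \<partial>(lborel \<Otimes>\<^sub>M M)) \<longlonglongrightarrow> 0) \<and>
    ((\<lambda>k. \<integral>\<^sup>+\<omega>. ennreal ((I \<omega> - simple_ito_integral B (n k) (\<tau> k) (\<xi> k) \<omega>)\<^sup>2) \<partial>M) \<longlonglongrightarrow> 0)"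

lemma extend_by_zero_measurable:
  assumes "has_ito_integral M F B t f I"
  shows "extend_by_zero t f \<in> borel_measurable (lborel \<Otimes>\<^sub>M M)"
proof -
  have f: "(\<lambda>(s, \<omega>). f s \<omega>) \<in> borel_measurable (time_space M t)"
    using assms unfolding has_ito_integral_def measurable_adapted_def by blast
  have "extend_by_zero t f = (\<lambda>x. if fst x \<in> {0..t} then (\<lambda>(s, \<omega>). f s \<omega>) x else 0)"
    by (auto simp: extend_by_zero_def fun_eq_iff)
  with measurable_time_space_extend[OF f] show ?thesis by simp
qed

lemma ex_ito_approximation:
  assumes I: "has_ito_integral M F B t f I" and t: "t \<in> {0..T}"
  shows "\<exists>n \<tau> \<xi>. ito_approximation t f I n \<tau> \<xi>"
proof -
  have f: "(\<lambda>(s, \<omega>). f s \<omega>) \<in> borel_measurable (time_space M t)"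
    using I unfolding has_ito_integral_def measurable_adapted_def by blast
  obtain n \<tau> \<xi> where s: "\<And>k. simple_integrand F t (n k) (\<tau> k) (\<xi> k)"
    and l: "(\<lambda>k. \<integral>\<^sup>+(s, \<omega>). ennreal ((f s \<omega> - simple_process (n k) (\<tau> k) (\<xi> k) s \<omega>)\<^sup>2)
                \<partial>time_space M t) \<longlonglongrightarrow> 0"
      "(\<lambda>k. \<integral>\<^sup>+\<omega>. ennreal ((I \<omega> - simple_ito_integral B (n k) (\<tau> k) (\<xi> k) \<omega>)\<^sup>2) \<partial>M) \<longlonglongrightarrow> 0"
    using I unfolding has_ito_integral_def by blast
  have \<xi>m: "\<xi> k i \<in> borel_measurable M" "B (\<tau> k i) \<in> borel_measurable M"
     "B (\<tau> k (Suc i)) \<in> borel_measurable M" if "i < n k" for k i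
  proof -
    have "\<tau> k i \<in> {0..T}" "\<tau> k (Suc i) \<in> {0..T}"
      using simple_integrand_bounds[OF s, of i k] simple_integrand_bounds[OF s, of "Suc i" k] that t
      by auto
    then show "\<xi> k i \<in> borel_measurable M" "B (\<tau> k i) \<in> borel_measurable M"
       "B (\<tau> k (Suc i)) \<in> borel_measurable M"
      using simple_integrand_weight(1)[OF s that] measurable_from_filtration adapted
      unfolding elementary_weight_def by blast+
  qed
  have sp: "(\<lambda>(s, \<omega>). simple_process (n k) (\<tau> k) (\<xi> k) s \<omega>) \<in> borel_measurable (lborel \<Otimes>\<^sub>M M)" for k
    unfolding simple_process_def split_beta
    using \<xi>m by (intro borel_measurable_sum borel_measurable_times) auto
  have si: "simple_ito_integral B (n k) (\<tau> k) (\<xi> k) \<in> borel_measurable M" for k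
    unfolding simple_ito_integral_def using \<xi>m by (intro borel_measurable_sum borel_measurable_times) auto
  have sp0: "simple_process (n k) (\<tau> k) (\<xi> k) s \<omega> = 0" if "s \<notin> {0..t}" for k s \<omega>
    unfolding simple_process_def
  proof (intro sum.neutral ballI)
    fix i assume "i \<in> {..<n k}"
    then show "\<xi> k i \<omega> * indicator {\<tau> k i<..\<tau> k (Suc i)} s = 0"
      using simple_integrand_bounds[OF s, of i k] simple_integrand_bounds[OF s, of "Suc i" k] that
      by (auto simp: indicator_def)
  qed
  have "(\<integral>\<^sup>+(s, \<omega>). ennreal ((f s \<omega> - simple_process (n k) (\<tau> k) (\<xi> k) s \<omega>)\<^sup>2) \<partial>time_space M t)
    = (\<integral>\<^sup>+x. ennreal ((extend_by_zero t f x -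
             (case x of (s, \<omega>) \<Rightarrow> simple_process (n k) (\<tau> k) (\<xi> k) s \<omega>))\<^sup>2) \<partial>(lborel \<Otimes>\<^sub>M M))" for k
  proof -
    have "(\<lambda>x. x) \<in> time_space M t \<rightarrow>\<^sub>M lborel \<Otimes>\<^sub>M M"
      by (rule measurable_pair)
         (auto simp: comp_def intro!: measurable_compose[OF measurable_fst] measurable_restrict_space1)
    from measurable_compose[OF this sp[of k]]
    have "(\<lambda>x. ennreal (((\<lambda>(s, \<omega>). f s \<omega>) x - (\<lambda>(s, \<omega>). simple_process (n k) (\<tau> k) (\<xi> k) s \<omega>) x)\<^sup>2))
        \<in> borel_measurable (time_space M t)"
      by (intro measurable_compose[OF _ measurable_ennreal] borel_measurable_power borel_measurable_diff f)
    then have m: "(\<lambda>(s, \<omega>). ennreal ((f s \<omega> - simple_process (n k) (\<tau> k) (\<xi> k) s \<omega>)\<^sup>2))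
        \<in> borel_measurable (time_space M t)" by (simp add: split_beta)
    show ?thesis
      unfolding nn_integral_time_space[OF sigma_finite_measure_axioms m]
      by (intro nn_integral_cong) (auto simp: extend_by_zero_def sp0)
  qed
  with l(1) have "(\<lambda>k. \<integral>\<^sup>+x. ennreal ((extend_by_zero t f x -
             (case x of (s, \<omega>) \<Rightarrow> simple_process (n k) (\<tau> k) (\<xi> k) s \<omega>))\<^sup>2) \<partial>(lborel \<Otimes>\<^sub>M M)) \<longlonglongrightarrow> 0"
    by simp
  with s sp si l(2) show ?thesis unfolding ito_approximation_def by blast
qed

text \<open>The isometry for integrals over possibly different intervals: the difference of the approximating
  sums satisfies it exactly by \<open>simple_ito_isometry\<close>, and both sides converge.\<close>
theorem ito_isometry_difference:
  assumes I: "has_ito_integral M F B s f I" "s \<in> {0..T}"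
    and J: "has_ito_integral M F B t g J" "t \<in> {0..T}"
  shows "(\<integral>\<^sup>+\<omega>. ennreal ((I \<omega> - J \<omega>)\<^sup>2) \<partial>M)
    = (\<integral>\<^sup>+u. \<integral>\<^sup>+\<omega>. ennreal ((extend_by_zero s f (u, \<omega>) - extend_by_zero t g (u, \<omega>))\<^sup>2) \<partial>M \<partial>lborel)"
proof -
  obtain n \<tau> \<xi> where appI: "ito_approximation s f I n \<tau> \<xi>" using ex_ito_approximation[OF I] by blast
  obtain m \<sigma> \<zeta> where appJ: "ito_approximation t g J m \<sigma> \<zeta>" using ex_ito_approximation[OF J] by blast
  note a1 = appI[unfolded ito_approximation_def] and a2 = appJ[unfolded ito_approximation_def]
  have [measurable]: "I \<in> borel_measurable M" "J \<in> borel_measurable M"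
    using I J unfolding has_ito_integral_def by auto
  note [measurable] = extend_by_zero_measurable[OF I(1)] extend_by_zero_measurable[OF J(1)]
  let ?SI = "\<lambda>k \<omega>. simple_ito_integral B (n k) (\<tau> k) (\<xi> k) \<omega>"
  let ?SJ = "\<lambda>k \<omega>. simple_ito_integral B (m k) (\<sigma> k) (\<zeta> k) \<omega>"
  let ?f = "extend_by_zero s f" and ?g = "extend_by_zero t g"
  define \<phi> where "\<phi> k = (\<lambda>(s, \<omega>). simple_process (n k) (\<tau> k) (\<xi> k) s \<omega>)" for k
  define \<psi> where "\<psi> k = (\<lambda>(s, \<omega>). simple_process (m k) (\<sigma> k) (\<zeta> k) s \<omega>)" for k
  have [measurable]: "?SI k \<in> borel_measurable M" "?SJ k \<in> borel_measurable M" for k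
    using a1 a2 by auto
  have [measurable]: "\<phi> k \<in> borel_measurable (lborel \<Otimes>\<^sub>M M)" "\<psi> k \<in> borel_measurable (lborel \<Otimes>\<^sub>M M)" for k
    using a1 a2 unfolding \<phi>_def \<psi>_def by auto
  have iso: "(\<integral>\<^sup>+\<omega>. ennreal ((?SI k \<omega> - ?SJ k \<omega>)\<^sup>2) \<partial>M)
     = (\<integral>\<^sup>+x. ennreal ((\<phi> k x - \<psi> k x)\<^sup>2) \<partial>(lborel \<Otimes>\<^sub>M M))" for k
  proof -
    have "simple_integrand F s (n k) (\<tau> k) (\<xi> k)" "simple_integrand F t (m k) (\<sigma> k) (\<zeta> k)"
      using a1 a2 by blast+
    from simple_ito_isometry[OF this(1) _ this(2)] I(2) J(2) show ?thesis
      by (simp add: \<phi>_def \<psi>_def case_prod_beta')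
  qed
  have diff: "(\<lambda>k. \<integral>\<^sup>+x. ennreal ((p x - q x - (pp k x - qq k x))\<^sup>2) \<partial>N) \<longlonglongrightarrow> 0"
    if [measurable]: "p \<in> borel_measurable N" "q \<in> borel_measurable N"
      "\<And>k. pp k \<in> borel_measurable N" "\<And>k. qq k \<in> borel_measurable N"
      and p: "(\<lambda>k. \<integral>\<^sup>+x. ennreal ((p x - pp k x)\<^sup>2) \<partial>N) \<longlonglongrightarrow> 0"
      and q: "(\<lambda>k. \<integral>\<^sup>+x. ennreal ((q x - qq k x)\<^sup>2) \<partial>N) \<longlonglongrightarrow> 0"
    for p q and pp qq :: "nat \<Rightarrow> 'z \<Rightarrow> real" and N :: "'z measure"
  proof (rule tendsto_sandwich[where f="\<lambda>_. 0"])
    show "(\<lambda>k. ennreal (1 + 1) * (\<integral>\<^sup>+x. ennreal ((p x - pp k x)\<^sup>2) \<partial>N)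
       + ennreal (1 + 1/1) * (\<integral>\<^sup>+x. ennreal ((q x - qq k x)\<^sup>2) \<partial>N)) \<longlonglongrightarrow> 0"
      using tendsto_add[OF ennreal_tendsto_cmult[OF _ p, of "ennreal (1+1)"]
          ennreal_tendsto_cmult[OF _ q, of "ennreal (1+1/1)"]] by simp
    have "(\<integral>\<^sup>+x. ennreal ((p x - q x - (pp k x - qq k x))\<^sup>2) \<partial>N)
       \<le> ennreal (1 + 1) * (\<integral>\<^sup>+x. ennreal ((p x - pp k x)\<^sup>2) \<partial>N)
       + ennreal (1 + 1/1) * (\<integral>\<^sup>+x. ennreal ((q x - qq k x)\<^sup>2) \<partial>N)" for k
      using nn_integral_add_square_le[of "\<lambda>x. p x - pp k x" N "\<lambda>x. qq k x - q x" 1]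
      by (simp add: power2_commute[of "qq k _"] algebra_simps)
    then show "\<forall>\<^sub>F k in sequentially. (\<integral>\<^sup>+x. ennreal ((p x - q x - (pp k x - qq k x))\<^sup>2) \<partial>N)
       \<le> ennreal (1 + 1) * (\<integral>\<^sup>+x. ennreal ((p x - pp k x)\<^sup>2) \<partial>N)
       + ennreal (1 + 1/1) * (\<integral>\<^sup>+x. ennreal ((q x - qq k x)\<^sup>2) \<partial>N)" by simp
  qed auto
  have dI: "(\<lambda>k. \<integral>\<^sup>+\<omega>. ennreal ((I \<omega> - J \<omega> - (?SI k \<omega> - ?SJ k \<omega>))\<^sup>2) \<partial>M) \<longlonglongrightarrow> 0"
    using a1 a2 by (intro diff) auto
  have df: "(\<lambda>k. \<integral>\<^sup>+x. ennreal ((?f x - ?g x - (\<phi> k x - \<psi> k x))\<^sup>2) \<partial>(lborel \<Otimes>\<^sub>M M)) \<longlonglongrightarrow> 0"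
  proof (rule diff)
    show "(\<lambda>k. \<integral>\<^sup>+x. ennreal ((?f x - \<phi> k x)\<^sup>2) \<partial>(lborel \<Otimes>\<^sub>M M)) \<longlonglongrightarrow> 0"
      unfolding \<phi>_def using a1 by blast
    show "(\<lambda>k. \<integral>\<^sup>+x. ennreal ((?g x - \<psi> k x)\<^sup>2) \<partial>(lborel \<Otimes>\<^sub>M M)) \<longlonglongrightarrow> 0"
      unfolding \<psi>_def using a2 by blast
  qed measurable
  have "(\<integral>\<^sup>+\<omega>. ennreal ((I \<omega> - J \<omega>)\<^sup>2) \<partial>M) \<le> (\<integral>\<^sup>+x. ennreal ((?f x - ?g x)\<^sup>2) \<partial>(lborel \<Otimes>\<^sub>M M))"
    by (rule L2_limit_le[OF _ _ _ _ dI df iso]) measurable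
  moreover have "(\<integral>\<^sup>+x. ennreal ((?f x - ?g x)\<^sup>2) \<partial>(lborel \<Otimes>\<^sub>M M)) \<le> (\<integral>\<^sup>+\<omega>. ennreal ((I \<omega> - J \<omega>)\<^sup>2) \<partial>M)"
    by (rule L2_limit_le[OF _ _ _ _ df dI iso[symmetric]]) measurable
  ultimately show ?thesis
    by (subst nn_integral_fst) auto
qed

end

section \<open>Kernels with a Hurst exponent and regularity of the solution\<close>

text \<open>The deterministic data. The lower bound of the Hurst function enters only through the range of
  \<open>h t x - 1/2 + \<kappa>\<close>. Keeping the probability space out of the locale ensures that no constant depends
  on it.\<close>
locale hurst_kernel =
  fixes T \<kappa> \<theta> C :: real and h :: "real \<Rightarrow> real \<Rightarrow> real"
  assumes T_pos: "0 < T" and \<kappa>: "0 \<le> \<kappa>" "2 * \<kappa> < 1" and \<theta>: "0 < \<theta>" "\<theta> \<le> 1" and C_nonneg: "0 \<le> C"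
    and exponent_range: "t \<in> {0..T} \<Longrightarrow> h t x - 1/2 + \<kappa> \<in> {\<theta>..1}"
    and lipschitz_space: "t \<in> {0..T} \<Longrightarrow> \<bar>h t x - h t y\<bar> \<le> C * \<bar>x - y\<bar>"
    and lipschitz_time: "s \<in> {0..T} \<Longrightarrow> t \<in> {0..T} \<Longrightarrow> \<bar>h s x - h t x\<bar> \<le> C * \<bar>s - t\<bar>"
begin

definition "kernel_const = 1/\<theta> + T\<^sup>2 + (1 + T) / \<theta>"

text \<open>The integral of the squared singular weight over \<open>{0..T}\<close>.\<close>
definition "singular_mass = T powr (1 - 2*\<kappa>) / (1 - 2*\<kappa>)"
definition "increment_const = ((kernel_const * (C * T powr (1 - \<theta>) + 1))\<^sup>2 + (1 + T)\<^sup>2) * singular_mass"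

lemma constants_nonneg: "0 \<le> kernel_const" "0 \<le> singular_mass" "0 \<le> increment_const"
  using T_pos \<theta> \<kappa> by (auto simp: kernel_const_def singular_mass_def increment_const_def)

text \<open>First the exponent is changed at the smaller base, then the base; the weight at the smaller base
  dominates both errors.\<close>
lemma kernel_difference:
  assumes "0 < x" "x \<le> y" "y \<le> T" "s \<in> {0..T}" "t \<in> {0..T}"
  shows "\<bar>x powr (h s z - 1/2) - y powr (h t w - 1/2)\<bar>
     \<le> kernel_const * x powr - \<kappa> * (\<bar>h s z - h t w\<bar> + (y - x) powr \<theta>)"
proof -
  let ?a = "h s z - 1/2" and ?b = "h t w - 1/2"
  have r: "?a + \<kappa> \<in> {\<theta>..1}" "?b + \<kappa> \<in> {\<theta>..1}" using exponent_range assms by blast+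
  have "\<bar>?b\<bar> \<le> 1" "?b + \<kappa> - \<theta> \<in> {0..1}" using r \<theta> \<kappa> by auto
  then have base: "\<bar>x powr ?b - y powr ?b\<bar> \<le> (1 + T) / \<theta> * x powr - \<kappa> * (y - x) powr \<theta>"
    using assms \<theta> \<kappa> by (intro powr_diff_base_le) auto
  have expo: "\<bar>x powr ?a - x powr ?b\<bar> \<le> (1/\<theta> + T\<^sup>2) * x powr - \<kappa> * \<bar>?a - ?b\<bar>"
    using assms \<theta> r by (intro powr_diff_exponent_le) auto
  have "\<bar>x powr ?a - y powr ?b\<bar> \<le> \<bar>x powr ?a - x powr ?b\<bar> + \<bar>x powr ?b - y powr ?b\<bar>" by simp
  also have "\<dots> \<le> (1/\<theta> + T\<^sup>2) * x powr - \<kappa> * \<bar>?a - ?b\<bar> + (1 + T) / \<theta> * x powr - \<kappa> * (y - x) powr \<theta>"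
    by (intro add_mono base expo)
  also have "\<dots> \<le> kernel_const * x powr - \<kappa> * \<bar>?a - ?b\<bar> + kernel_const * x powr - \<kappa> * (y - x) powr \<theta>"
    using T_pos \<theta> by (intro add_mono mult_right_mono) (auto simp: kernel_const_def)
  finally show ?thesis by (simp add: algebra_simps)
qed

lemma kernel_size:
  assumes "0 < x" "x \<le> T" "t \<in> {0..T}"
  shows "x powr (h t z - 1/2) \<le> (1 + T) * x powr - \<kappa> * x powr \<theta>"
proof -
  have r: "h t z - 1/2 + \<kappa> \<in> {\<theta>..1}" using exponent_range assms by blast
  have "x powr (h t z - 1/2) = x powr (h t z - 1/2 + \<kappa> - \<theta>) * x powr - \<kappa> * x powr \<theta>"
    by (simp flip: powr_add)
  also have "\<dots> \<le> (1 + T) * x powr - \<kappa> * x powr \<theta>"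
    using r assms \<theta> by (intro mult_right_mono powr_le_one_plus) auto
  finally show ?thesis .
qed

lemma singular_integral_le:
  assumes "0 \<le> s" "s \<le> t" "t \<le> T" "0 \<le> c"
  shows "(\<integral>\<^sup>+u. indicator {s..t} u * ennreal (c * (t - u) powr - (2*\<kappa>)) \<partial>lborel) \<le> ennreal (c * singular_mass)"
proof -
  have "(\<integral>\<^sup>+u. indicator {s..t} u * ennreal (c * (t - u) powr - (2*\<kappa>)) \<partial>lborel)
    = (\<integral>\<^sup>+u. ennreal c * (indicator {s..t} u * ennreal ((t - u) powr - (2*\<kappa>))) \<partial>lborel)"
    using assms by (intro nn_integral_cong) (simp add: ennreal_mult' mult_ac)
  also have "\<dots> = ennreal c * ennreal ((t - s) powr (1 - 2*\<kappa>) / (1 - 2*\<kappa>))"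
    using assms \<kappa> by (subst nn_integral_cmult) (simp_all add: nn_integral_powr_singular)
  also have "\<dots> \<le> ennreal c * ennreal singular_mass"
    unfolding singular_mass_def using assms \<kappa>
    by (intro mult_left_mono ennreal_leI divide_right_mono powr_mono2) auto
  finally show ?thesis using assms by (simp add: ennreal_mult')
qed

lemma square_powr_minus: "(x powr - \<kappa>)\<^sup>2 = x powr - (2*\<kappa>)" "(x powr \<theta>)\<^sup>2 = x powr (2*\<theta>)" for x :: real
  by (simp_all add: power2_eq_square flip: powr_add)

text \<open>Up to time \<open>s\<close> the kernels at \<open>t\<close> and \<open>s\<close> are compared, with \<open>\<bar>h s z - h t z\<bar>\<close> of order
  \<open>t - s \<le> const * (t - s) powr \<theta>\<close>. After \<open>s\<close> only the kernel at \<open>t\<close> is present, and it is small because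
  \<open>t - u \<le> t - s\<close>.\<close>
lemma solution_kernel_increment:
  assumes "0 \<le> s" "s < t" "t \<le> T"
  shows "((if u \<in> {0..t} then (t - u) powr (h t z - 1/2) else 0)
        - (if u \<in> {0..s} then (s - u) powr (h s z - 1/2) else 0))\<^sup>2
     \<le> indicator {0..s} u * ((kernel_const * (C * T powr (1 - \<theta>) + 1) * (t - s) powr \<theta>)\<^sup>2 * (s - u) powr - (2*\<kappa>))
       + indicator {s..t} u * (((1 + T) * (t - s) powr \<theta>)\<^sup>2 * (t - u) powr - (2*\<kappa>))"
proof -
  consider "0 \<le> u" "u < s" | "s \<le> u" "u < t" | "u \<notin> {0..<t}" by fastforce
  then show ?thesis
  proof cases
    case 1
    have "\<bar>h s z - h t z\<bar> \<le> C * (t - s)" using lipschitz_time[of s t z] assms by auto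
    also have "t - s = (t - s) powr (1 - \<theta>) * (t - s) powr \<theta>" using assms by (simp flip: powr_add)
    also have "C * \<dots> \<le> C * (T powr (1 - \<theta>) * (t - s) powr \<theta>)"
      using assms \<theta> C_nonneg by (intro mult_left_mono mult_right_mono powr_mono2) auto
    finally have h: "\<bar>h s z - h t z\<bar> \<le> C * T powr (1 - \<theta>) * (t - s) powr \<theta>" by simp
    have "\<bar>(t - u) powr (h t z - 1/2) - (s - u) powr (h s z - 1/2)\<bar>
        = \<bar>(s - u) powr (h s z - 1/2) - (t - u) powr (h t z - 1/2)\<bar>" by simp
    also have "\<dots> \<le> kernel_const * (s - u) powr - \<kappa> * (\<bar>h s z - h t z\<bar> + (t - s) powr \<theta>)"
      using kernel_difference[of "s - u" "t - u" s t z z] 1 assms by auto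
    also have "\<dots> \<le> kernel_const * (s - u) powr - \<kappa> * (C * T powr (1 - \<theta>) * (t - s) powr \<theta> + (t - s) powr \<theta>)"
      using h constants_nonneg by (intro mult_left_mono add_right_mono) auto
    also have "\<dots> = kernel_const * (C * T powr (1 - \<theta>) + 1) * (t - s) powr \<theta> * (s - u) powr - \<kappa>"
      by (simp add: algebra_simps)
    finally have "\<bar>(t - u) powr (h t z - 1/2) - (s - u) powr (h s z - 1/2)\<bar>\<^sup>2
       \<le> (kernel_const * (C * T powr (1 - \<theta>) + 1) * (t - s) powr \<theta> * (s - u) powr - \<kappa>)\<^sup>2"
      by (intro power_mono) auto
    then show ?thesis using 1 assms by (simp add: power_mult_distrib square_powr_minus)
  next
    case 2
    have "(t - u) powr (h t z - 1/2) \<le> (1 + T) * (t - u) powr - \<kappa> * (t - u) powr \<theta>"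
      using 2 assms by (intro kernel_size) auto
    also have "\<dots> \<le> (1 + T) * (t - u) powr - \<kappa> * (t - s) powr \<theta>"
      using 2 assms T_pos \<theta> by (intro mult_left_mono powr_mono2) auto
    finally have "((t - u) powr (h t z - 1/2))\<^sup>2 \<le> ((1 + T) * (t - u) powr - \<kappa> * (t - s) powr \<theta>)\<^sup>2"
      by (intro power_mono) auto
    then have "((t - u) powr (h t z - 1/2))\<^sup>2 \<le> ((1 + T) * (t - s) powr \<theta>)\<^sup>2 * (t - u) powr - (2*\<kappa>)"
      by (simp add: power_mult_distrib square_powr_minus mult_ac)
    then show ?thesis using 2 assms by (cases "u = s") (auto simp: add_increasing)
  next
    case 3
    then show ?thesis using assms by (cases "u = t") auto
  qed
qed

lemma solution_increment:
  assumes bm: "brownian_motion M F T B" and X: "volterra_solution M F T B h X"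
    and st: "0 \<le> s" "s \<le> t" "t \<le> T"
  shows "(\<integral>\<^sup>+\<omega>. ennreal ((X t \<omega> - X s \<omega>)\<^sup>2) \<partial>M) \<le> ennreal (increment_const * (t - s) powr (2*\<theta>))"
proof (cases "s = t")
  case False
  with st have less: "s < t" by simp
  interpret brownian_motion M F T B by fact
  let ?f = "\<lambda>t s \<omega>. (t - s) powr (h t (X s \<omega>) - 1/2)"
  let ?p = "(kernel_const * (C * T powr (1 - \<theta>) + 1) * (t - s) powr \<theta>)\<^sup>2" and ?q = "((1 + T) * (t - s) powr \<theta>)\<^sup>2"
  let ?P = "\<lambda>u. indicator {0..s} u * ennreal (?p * (s - u) powr - (2*\<kappa>))"
  let ?Q = "\<lambda>u. indicator {s..t} u * ennreal (?q * (t - u) powr - (2*\<kappa>))"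
  have ito: "has_ito_integral M F B t (?f t) (X t)" "has_ito_integral M F B s (?f s) (X s)"
    using X st unfolding volterra_solution_def by auto
  have "(\<integral>\<^sup>+\<omega>. ennreal ((X t \<omega> - X s \<omega>)\<^sup>2) \<partial>M)
     = (\<integral>\<^sup>+u. \<integral>\<^sup>+\<omega>. ennreal ((extend_by_zero t (?f t) (u, \<omega>) - extend_by_zero s (?f s) (u, \<omega>))\<^sup>2) \<partial>M \<partial>lborel)"
    using st by (intro ito_isometry_difference ito) auto
  also have "\<dots> \<le> (\<integral>\<^sup>+u. \<integral>\<^sup>+\<omega>. (?P u + ?Q u) \<partial>M \<partial>lborel)"
  proof (intro nn_integral_mono)
    fix u :: real and \<omega>
    have "ennreal ((extend_by_zero t (?f t) (u, \<omega>) - extend_by_zero s (?f s) (u, \<omega>))\<^sup>2)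
      \<le> ennreal (indicator {0..s} u * (?p * (s - u) powr - (2*\<kappa>)) + indicator {s..t} u * (?q * (t - u) powr - (2*\<kappa>)))"
      unfolding extend_by_zero_def fst_conv snd_conv
      by (intro ennreal_leI solution_kernel_increment st less)
    also have "\<dots> = ?P u + ?Q u"
      by (simp add: indicator_def)
    finally show "ennreal ((extend_by_zero t (?f t) (u, \<omega>) - extend_by_zero s (?f s) (u, \<omega>))\<^sup>2) \<le> ?P u + ?Q u" .
  qed
  also have "\<dots> = (\<integral>\<^sup>+u. ?P u \<partial>lborel) + (\<integral>\<^sup>+u. ?Q u \<partial>lborel)"
    by (simp add: emeasure_space_1 nn_integral_add)
  also have "\<dots> \<le> ennreal (?p * singular_mass) + ennreal (?q * singular_mass)"
    using st by (intro add_mono singular_integral_le) auto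
  also have "\<dots> = ennreal (?p * singular_mass + ?q * singular_mass)"
    using constants_nonneg by (intro ennreal_plus[symmetric]) auto
  also have "?p * singular_mass + ?q * singular_mass = increment_const * (t - s) powr (2*\<theta>)"
  proof -
    have "a * w * singular_mass + b * w * singular_mass = (a + b) * singular_mass * w" for a b w by (simp add: algebra_simps)
    then show ?thesis unfolding increment_const_def power_mult_distrib[of _ "(t - s) powr \<theta>"] square_powr_minus(2) .
  qed
  finally show ?thesis .
qed (simp add: constants_nonneg)

text \<open>Crude, but independent of \<open>X\<close> and \<open>Y\<close>; it provides the finiteness that the Gronwall lemma needs.\<close>
lemma scheme_kernel_bounded:
  assumes "0 \<le> r" "r \<le> u" "u < t" "t \<le> T"
  shows "((t - u) powr (h t z - 1/2) - (t - r) powr (h t w - 1/2))\<^sup>2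
     \<le> (kernel_const * (1 + T powr \<theta>))\<^sup>2 * (t - u) powr - (2*\<kappa>)"
proof -
  have t: "t \<in> {0..T}" using assms by auto
  have "\<bar>(t - u) powr (h t z - 1/2) - (t - r) powr (h t w - 1/2)\<bar>
     \<le> kernel_const * (t - u) powr - \<kappa> * (\<bar>h t z - h t w\<bar> + (u - r) powr \<theta>)"
    using kernel_difference[of "t - u" "t - r" t t z w] assms by auto
  also have "\<dots> \<le> kernel_const * (t - u) powr - \<kappa> * (1 + T powr \<theta>)"
    using assms constants_nonneg \<theta> exponent_range[OF t, of z] exponent_range[OF t, of w]
    by (intro mult_left_mono add_mono powr_mono2) auto
  finally have "\<bar>(t - u) powr (h t z - 1/2) - (t - r) powr (h t w - 1/2)\<bar>\<^sup>2
     \<le> (kernel_const * (t - u) powr - \<kappa> * (1 + T powr \<theta>))\<^sup>2"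
    by (intro power_mono) auto
  then show ?thesis by (simp add: power_mult_distrib square_powr_minus mult_ac)
qed

text \<open>The intermediate value \<open>v\<close> will be the solution at the grid point \<open>r\<close>: \<open>z - v\<close> is then an increment of
  the solution and \<open>v - w\<close> the error of the scheme.\<close>
lemma scheme_kernel_error:
  assumes "0 \<le> r" "r \<le> u" "u < t" "t \<le> T" "u - r \<le> \<Delta>"
  shows "((t - u) powr (h t z - 1/2) - (t - r) powr (h t w - 1/2))\<^sup>2
     \<le> 3 * kernel_const\<^sup>2 * (t - u) powr - (2*\<kappa>) * (C\<^sup>2 * (z - v)\<^sup>2 + C\<^sup>2 * (v - w)\<^sup>2 + \<Delta> powr (2*\<theta>))"
proof -
  have t: "t \<in> {0..T}" using assms by auto
  have sq3: "(a + b + c)\<^sup>2 \<le> 3 * (a\<^sup>2 + b\<^sup>2 + c\<^sup>2)" for a b c :: real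
  proof -
    have "0 \<le> (a - b)\<^sup>2 + (b - c)\<^sup>2 + (a - c)\<^sup>2" by simp
    then show ?thesis by (simp add: power2_eq_square algebra_simps)
  qed
  have "\<bar>(t - u) powr (h t z - 1/2) - (t - r) powr (h t w - 1/2)\<bar>
     \<le> kernel_const * (t - u) powr - \<kappa> * (\<bar>h t z - h t w\<bar> + (u - r) powr \<theta>)"
    using kernel_difference[of "t - u" "t - r" t t z w] assms by auto
  also have "\<dots> \<le> kernel_const * (t - u) powr - \<kappa> * (C * \<bar>z - v\<bar> + C * \<bar>v - w\<bar> + \<Delta> powr \<theta>)"
  proof (intro mult_left_mono add_mono)
    have "\<bar>h t z - h t w\<bar> \<le> \<bar>h t z - h t v\<bar> + \<bar>h t v - h t w\<bar>" by simp
    also have "\<dots> \<le> C * \<bar>z - v\<bar> + C * \<bar>v - w\<bar>" by (intro add_mono lipschitz_space t)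
    finally show "\<bar>h t z - h t w\<bar> \<le> C * \<bar>z - v\<bar> + C * \<bar>v - w\<bar>" .
  qed (use assms \<theta> constants_nonneg in \<open>auto intro!: powr_mono2\<close>)
  finally have "\<bar>(t - u) powr (h t z - 1/2) - (t - r) powr (h t w - 1/2)\<bar>\<^sup>2
     \<le> (kernel_const * (t - u) powr - \<kappa> * (C * \<bar>z - v\<bar> + C * \<bar>v - w\<bar> + \<Delta> powr \<theta>))\<^sup>2"
    by (intro power_mono) auto
  also have "\<dots> \<le> kernel_const\<^sup>2 * (t - u) powr - (2*\<kappa>) *
      (3 * ((C * \<bar>z - v\<bar>)\<^sup>2 + (C * \<bar>v - w\<bar>)\<^sup>2 + (\<Delta> powr \<theta>)\<^sup>2))"
    unfolding power_mult_distrib[of "kernel_const * _"] power_mult_distrib[of kernel_const] square_powr_minus(1)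
    by (intro mult_left_mono sq3) auto
  finally show ?thesis by (simp only: power_mult_distrib square_powr_minus power2_abs mult_ac)
qed

end

section \<open>Strong convergence of the Euler--Maruyama scheme\<close>

lemma grid_floor_bounds:
  assumes "0 < \<Delta>" "0 \<le> s"
  shows "0 \<le> grid_floor \<Delta> s" "grid_floor \<Delta> s \<le> s" "s - grid_floor \<Delta> s \<le> \<Delta>"
proof -
  have "of_int \<lfloor>s / \<Delta>\<rfloor> * \<Delta> \<le> s / \<Delta> * \<Delta>" "s / \<Delta> * \<Delta> \<le> (of_int \<lfloor>s / \<Delta>\<rfloor> + 1) * \<Delta>"
    using assms by (intro mult_right_mono; linarith)+
  then show "grid_floor \<Delta> s \<le> s" "s - grid_floor \<Delta> s \<le> \<Delta>"
    using assms by (simp_all add: grid_floor_def algebra_simps)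
  show "0 \<le> grid_floor \<Delta> s" using assms by (simp add: grid_floor_def)
qed

context hurst_kernel
begin

context
  fixes M :: "'a measure" and F B X Y N
  assumes bm: "brownian_motion M F T B" and X: "volterra_solution M F T B h X"
    and N: "1 \<le> N" and Y: "euler_maruyama_scheme M F T B h N Y"
begin

interpretation brownian_motion M F T B by (fact bm)

private abbreviation "\<Delta> \<equiv> T / real N"
private abbreviation "\<eta> \<equiv> grid_floor \<Delta>"
private abbreviation "err t \<equiv> \<integral>\<^sup>+\<omega>. ennreal ((X t \<omega> - Y t \<omega>)\<^sup>2) \<partial>M"

lemma step_pos: "0 < \<Delta>"
  using T_pos N by simp

text \<open>At \<open>u = t\<close> the two kernels are unrelated, since \<open>0 powr a = 0\<close> while \<open>t - \<eta> t\<close> may be positive; this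
  single time is negligible.\<close>
lemma error_isometry:
  assumes t: "t \<in> {0..T}" and
    bound: "\<And>u. 0 \<le> u \<Longrightarrow> u < t \<Longrightarrow>
      (\<integral>\<^sup>+\<omega>. ennreal (((t - u) powr (h t (X u \<omega>) - 1/2) - (t - \<eta> u) powr (h t (Y (\<eta> u) \<omega>) - 1/2))\<^sup>2) \<partial>M) \<le> G u"
  shows "err t \<le> (\<integral>\<^sup>+u. indicator {0..t} u * G u \<partial>lborel)"
proof -
  let ?f = "\<lambda>u \<omega>. (t - u) powr (h t (X u \<omega>) - 1/2)"
  let ?g = "\<lambda>u \<omega>. (t - \<eta> u) powr (h t (Y (\<eta> u) \<omega>) - 1/2)"
  have "has_ito_integral M F B t ?f (X t)" "has_ito_integral M F B t ?g (Y t)"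
    using X Y t unfolding volterra_solution_def euler_maruyama_scheme_def by auto
  then have "err t
     = (\<integral>\<^sup>+u. \<integral>\<^sup>+\<omega>. ennreal ((extend_by_zero t ?f (u, \<omega>) - extend_by_zero t ?g (u, \<omega>))\<^sup>2) \<partial>M \<partial>lborel)"
    using t by (intro ito_isometry_difference)
  also have "\<dots> \<le> (\<integral>\<^sup>+u. indicator {0..t} u * G u \<partial>lborel)"
  proof (rule nn_integral_mono_AE)
    show "AE u in lborel. (\<integral>\<^sup>+\<omega>. ennreal ((extend_by_zero t ?f (u, \<omega>) - extend_by_zero t ?g (u, \<omega>))\<^sup>2) \<partial>M)
       \<le> indicator {0..t} u * G u"
      using AE_lborel_singleton[of t]
    proof eventually_elim
      case (elim u)
      show ?case
      proof (cases "u \<in> {0..t}")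
        case True
        then show ?thesis using bound[of u] elim by (simp add: extend_by_zero_def)
      next
        case False
        then have "extend_by_zero t ?f (u, \<omega>) = 0" "extend_by_zero t ?g (u, \<omega>) = 0" for \<omega>
          unfolding extend_by_zero_def by auto
        then show ?thesis by simp
      qed
    qed
  qed
  finally show ?thesis .
qed

lemma error_bounded:
  assumes t: "t \<in> {0..T}"
  shows "err t \<le> ennreal ((kernel_const * (1 + T powr \<theta>))\<^sup>2 * singular_mass)"
proof -
  let ?c = "(kernel_const * (1 + T powr \<theta>))\<^sup>2"
  have "err t \<le> (\<integral>\<^sup>+u. indicator {0..t} u * ennreal (?c * (t - u) powr - (2*\<kappa>)) \<partial>lborel)"
  proof (rule error_isometry[OF t])
    fix u assume u: "0 \<le> u" "u < t"
    have "(\<integral>\<^sup>+\<omega>. ennreal (((t - u) powr (h t (X u \<omega>) - 1/2) - (t - \<eta> u) powr (h t (Y (\<eta> u) \<omega>) - 1/2))\<^sup>2) \<partial>M)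
      \<le> (\<integral>\<^sup>+\<omega>. ennreal (?c * (t - u) powr - (2*\<kappa>)) \<partial>M)"
      using u t grid_floor_bounds[OF step_pos, of u]
      by (intro nn_integral_mono ennreal_leI scheme_kernel_bounded) auto
    then show "(\<integral>\<^sup>+\<omega>. ennreal (((t - u) powr (h t (X u \<omega>) - 1/2) - (t - \<eta> u) powr (h t (Y (\<eta> u) \<omega>) - 1/2))\<^sup>2) \<partial>M)
      \<le> ennreal (?c * (t - u) powr - (2*\<kappa>))" by (simp add: emeasure_space_1)
  qed
  also have "\<dots> \<le> ennreal (?c * singular_mass)"
    using t by (intro singular_integral_le) auto
  finally show ?thesis .
qed

text \<open>\<open>X u - Y (\<eta> u)\<close> splits at \<open>X (\<eta> u)\<close>. The increment of \<open>X\<close> over less than one step joins the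
  discretisation error of the kernel in the inhomogeneous term, and only errors at grid points remain
  under the integral.\<close>
lemma error_recursion:
  assumes t: "t \<in> {0..T}"
  shows "err t \<le> ennreal (3 * kernel_const\<^sup>2 * (C\<^sup>2 * increment_const + 1) * singular_mass * \<Delta> powr (2*\<theta>))
    + (\<integral>\<^sup>+u. indicator {0..t} u * (ennreal (3 * kernel_const\<^sup>2 * C\<^sup>2 * (t - u) powr - (2*\<kappa>)) * err (\<eta> u)) \<partial>lborel)"
proof -
  let ?k = "\<lambda>u. (t - u) powr - (2*\<kappa>)"
  let ?c = "3 * kernel_const\<^sup>2 * (C\<^sup>2 * increment_const + 1) * \<Delta> powr (2*\<theta>)"
  have "err t \<le> (\<integral>\<^sup>+u. indicator {0..t} u *
      (ennreal (?c * ?k u) + ennreal (3 * kernel_const\<^sup>2 * C\<^sup>2 * ?k u) * err (\<eta> u)) \<partial>lborel)"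
  proof (rule error_isometry[OF t])
    fix u assume u: "0 \<le> u" "u < t"
    note \<eta> = grid_floor_bounds[OF step_pos u(1)]
    have \<eta>T: "\<eta> u \<in> {0..T}" "u \<in> {0..T}" using \<eta> u t by auto
    have [measurable]: "X u \<in> borel_measurable M" "X (\<eta> u) \<in> borel_measurable M" "Y (\<eta> u) \<in> borel_measurable M"
      using X Y \<eta>T unfolding volterra_solution_def euler_maruyama_scheme_def has_ito_integral_def by blast+
    let ?a = "3 * kernel_const\<^sup>2 * ?k u"
    have "(\<integral>\<^sup>+\<omega>. ennreal (((t - u) powr (h t (X u \<omega>) - 1/2) - (t - \<eta> u) powr (h t (Y (\<eta> u) \<omega>) - 1/2))\<^sup>2) \<partial>M)
      \<le> (\<integral>\<^sup>+\<omega>. ennreal (?a * C\<^sup>2) * ennreal ((X u \<omega> - X (\<eta> u) \<omega>)\<^sup>2)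
            + ennreal (?a * C\<^sup>2) * ennreal ((X (\<eta> u) \<omega> - Y (\<eta> u) \<omega>)\<^sup>2) + ennreal (?a * \<Delta> powr (2*\<theta>)) \<partial>M)"
    proof (intro nn_integral_mono)
      fix \<omega>
      have "((t - u) powr (h t (X u \<omega>) - 1/2) - (t - \<eta> u) powr (h t (Y (\<eta> u) \<omega>) - 1/2))\<^sup>2
        \<le> ?a * (C\<^sup>2 * (X u \<omega> - X (\<eta> u) \<omega>)\<^sup>2 + C\<^sup>2 * (X (\<eta> u) \<omega> - Y (\<eta> u) \<omega>)\<^sup>2 + \<Delta> powr (2*\<theta>))"
        using u t \<eta> by (intro scheme_kernel_error) auto
      also have "\<dots> = ?a * C\<^sup>2 * (X u \<omega> - X (\<eta> u) \<omega>)\<^sup>2 + ?a * C\<^sup>2 * (X (\<eta> u) \<omega> - Y (\<eta> u) \<omega>)\<^sup>2 + ?a * \<Delta> powr (2*\<theta>)"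
        by (simp add: algebra_simps)
      finally show "ennreal (((t - u) powr (h t (X u \<omega>) - 1/2) - (t - \<eta> u) powr (h t (Y (\<eta> u) \<omega>) - 1/2))\<^sup>2)
        \<le> ennreal (?a * C\<^sup>2) * ennreal ((X u \<omega> - X (\<eta> u) \<omega>)\<^sup>2)
            + ennreal (?a * C\<^sup>2) * ennreal ((X (\<eta> u) \<omega> - Y (\<eta> u) \<omega>)\<^sup>2) + ennreal (?a * \<Delta> powr (2*\<theta>))"
        by (simp flip: ennreal_mult ennreal_plus)
    qed
    also have "\<dots> = ennreal (?a * C\<^sup>2) * (\<integral>\<^sup>+\<omega>. ennreal ((X u \<omega> - X (\<eta> u) \<omega>)\<^sup>2) \<partial>M)
        + ennreal (?a * C\<^sup>2) * err (\<eta> u) + ennreal (?a * \<Delta> powr (2*\<theta>))"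
      by (simp add: nn_integral_add nn_integral_cmult emeasure_space_1)
    also have "\<dots> \<le> ennreal (?a * C\<^sup>2) * ennreal (increment_const * \<Delta> powr (2*\<theta>))
        + ennreal (?a * C\<^sup>2) * err (\<eta> u) + ennreal (?a * \<Delta> powr (2*\<theta>))"
    proof (intro add_mono mult_left_mono order_refl)
      have "(\<integral>\<^sup>+\<omega>. ennreal ((X u \<omega> - X (\<eta> u) \<omega>)\<^sup>2) \<partial>M) \<le> ennreal (increment_const * (u - \<eta> u) powr (2*\<theta>))"
        using \<eta> \<eta>T by (intro solution_increment[OF bm X]) auto
      also have "\<dots> \<le> ennreal (increment_const * \<Delta> powr (2*\<theta>))"
        using \<eta> \<theta> constants_nonneg by (intro ennreal_leI mult_left_mono powr_mono2) auto
      finally show "(\<integral>\<^sup>+\<omega>. ennreal ((X u \<omega> - X (\<eta> u) \<omega>)\<^sup>2) \<partial>M) \<le> ennreal (increment_const * \<Delta> powr (2*\<theta>))" .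
    qed auto
    also have "\<dots> = (ennreal (?a * C\<^sup>2) * ennreal (increment_const * \<Delta> powr (2*\<theta>)) + ennreal (?a * \<Delta> powr (2*\<theta>)))
        + ennreal (?a * C\<^sup>2) * err (\<eta> u)" by (simp add: add_ac)
    also have "ennreal (?a * C\<^sup>2) * ennreal (increment_const * \<Delta> powr (2*\<theta>)) + ennreal (?a * \<Delta> powr (2*\<theta>)) = ennreal (?c * ?k u)"
      using constants_nonneg by (simp add: algebra_simps flip: ennreal_mult ennreal_plus)
    finally show "(\<integral>\<^sup>+\<omega>. ennreal (((t - u) powr (h t (X u \<omega>) - 1/2) - (t - \<eta> u) powr (h t (Y (\<eta> u) \<omega>) - 1/2))\<^sup>2) \<partial>M)
       \<le> ennreal (?c * ?k u) + ennreal (3 * kernel_const\<^sup>2 * C\<^sup>2 * ?k u) * err (\<eta> u)"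
      by (simp add: mult_ac)
  qed
  also have "\<dots> = (\<integral>\<^sup>+u. indicator {0..t} u * ennreal (?c * ?k u)
      + indicator {0..t} u * (ennreal (3 * kernel_const\<^sup>2 * C\<^sup>2 * ?k u) * err (\<eta> u)) \<partial>lborel)"
    by (simp add: distrib_left)
  also have "\<dots> = (\<integral>\<^sup>+u. indicator {0..t} u * ennreal (?c * ?k u) \<partial>lborel)
     + (\<integral>\<^sup>+u. indicator {0..t} u * (ennreal (3 * kernel_const\<^sup>2 * C\<^sup>2 * ?k u) * err (\<eta> u)) \<partial>lborel)"
  proof (rule nn_integral_add)
    \<comment> \<open>the error at the preceding grid point is a step function of time, hence measurable\<close>
    have "(\<lambda>u. \<lfloor>u / \<Delta>\<rfloor>) \<in> borel \<rightarrow>\<^sub>M count_space UNIV" by measurable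
    then have [measurable]: "(\<lambda>u. err (\<eta> u)) \<in> borel_measurable borel"
      unfolding grid_floor_def by (rule measurable_compose) simp
    show "(\<lambda>u. indicator {0..t} u * (ennreal (3 * kernel_const\<^sup>2 * C\<^sup>2 * ?k u) * err (\<eta> u))) \<in> borel_measurable lborel"
      by measurable
  qed measurable
  also have "(\<integral>\<^sup>+u. indicator {0..t} u * ennreal (?c * ?k u) \<partial>lborel) \<le> ennreal (?c * singular_mass)"
    using t constants_nonneg by (intro singular_integral_le) auto
  also have "?c * singular_mass = 3 * kernel_const\<^sup>2 * (C\<^sup>2 * increment_const + 1) * singular_mass * \<Delta> powr (2*\<theta>)" by simp
  finally show ?thesis by (simp add: add_right_mono)
qed

end

text \<open>The constant is fixed before the probability space and \<open>N\<close>: the Gronwall constant depends only on the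
  kernel in the recursion.\<close>
theorem strong_error:
  "\<exists>K>0. \<forall>(M :: 'a measure) F B X N Y t. brownian_motion M F T B \<longrightarrow> volterra_solution M F T B h X \<longrightarrow>
     1 \<le> N \<longrightarrow> euler_maruyama_scheme M F T B h N Y \<longrightarrow> t \<in> {0..T} \<longrightarrow>
     (\<integral>\<^sup>+\<omega>. ennreal ((X t \<omega> - Y t \<omega>)\<^sup>2) \<partial>M) \<le> ennreal (K * (T / real N) powr (2*\<theta>))"
proof -
  obtain G where G: "0 < G" and gronwall: "\<forall>(f :: real \<Rightarrow> ennreal) \<eta> A R. 0 \<le> A \<longrightarrow>
    (\<forall>t\<in>{0..T}. f t \<le> ennreal R) \<longrightarrow>
    (\<forall>s\<in>{0..T}. \<eta> s \<in> {0..s}) \<longrightarrow>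
    (\<forall>t\<in>{0..T}. f t \<le> ennreal A
       + (\<integral>\<^sup>+s. indicator {0..t} s * (ennreal (3 * kernel_const\<^sup>2 * C\<^sup>2 * (t - s) powr - (2*\<kappa>)) * f (\<eta> s)) \<partial>lborel)) \<longrightarrow>
    (\<forall>t\<in>{0..T}. f t \<le> ennreal (G * A))"
    using singular_gronwall[of T "3 * kernel_const\<^sup>2 * C\<^sup>2" "2*\<kappa>"] T_pos \<kappa> by auto
  let ?A = "3 * kernel_const\<^sup>2 * (C\<^sup>2 * increment_const + 1) * singular_mass"
  have A: "0 \<le> ?A" using constants_nonneg by simp
  show ?thesis
  \<comment> \<open>the summand \<open>1\<close> only makes the constant positive\<close>
  proof (intro exI[of _ "G * ?A + 1"] conjI allI impI)
    show "0 < G * ?A + 1" using G A by (simp add: add_nonneg_pos)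
    fix M :: "'a measure" and F B X N Y t
    assume bm: "brownian_motion M F T B" and X: "volterra_solution M F T B h X" and N: "1 \<le> N"
      and Y: "euler_maruyama_scheme M F T B h N Y" and t: "t \<in> {0..T}"
    have "(\<integral>\<^sup>+\<omega>. ennreal ((X t \<omega> - Y t \<omega>)\<^sup>2) \<partial>M) \<le> ennreal (G * (?A * (T / real N) powr (2*\<theta>)))"
    proof (rule gronwall[rule_format, where f = "\<lambda>t. \<integral>\<^sup>+\<omega>. ennreal ((X t \<omega> - Y t \<omega>)\<^sup>2) \<partial>M"
          and \<eta> = "grid_floor (T / real N)" and R = "(kernel_const * (1 + T powr \<theta>))\<^sup>2 * singular_mass"])
      show "0 \<le> ?A * (T / real N) powr (2*\<theta>)" using A by simp
      show "grid_floor (T / real N) s \<in> {0..s}" if "s \<in> {0..T}" for s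
        using grid_floor_bounds[of "T / real N" s] T_pos N that by auto
    qed (fact error_bounded[OF bm X N Y] error_recursion[OF bm X N Y] t)+
    also have "\<dots> \<le> ennreal ((G * ?A + 1) * (T / real N) powr (2*\<theta>))"
      by (intro ennreal_leI) (simp add: distrib_right)
    finally show "(\<integral>\<^sup>+\<omega>. ennreal ((X t \<omega> - Y t \<omega>)\<^sup>2) \<partial>M) \<le> ennreal ((G * ?A + 1) * (T / real N) powr (2*\<theta>))" .
  qed
qed

end

theorem theorem9:
  fixes T hlo hhi \<gamma> :: real and h :: "real \<Rightarrow> real \<Rightarrow> real"
  assumes "T > 0"
    and "hurst_function T hlo hhi h"
    and "\<gamma> \<in> {0<..<2 * hlo}"
  shows "\<exists>C>0. \<forall>(M :: 'a measure) F B X.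
           brownian_motion M F T B \<longrightarrow> volterra_solution M F T B h X \<longrightarrow>
           (\<forall>N\<ge>1. \<forall>Y. euler_maruyama_scheme M F T B h N Y \<longrightarrow>
              (SUP t\<in>{0..T}. \<integral>\<^sup>+\<omega>. ennreal (\<bar>X t \<omega> - Y t \<omega>\<bar>\<^sup>2) \<partial>M)
                \<le> ennreal (C * mittag_leffler hlo (C * Gamma hlo * T powr hlo) *
                            \<bar>T / real N\<bar> powr \<gamma>))"
proof -
  have hb: "0 < hlo" "hlo \<le> hhi" "hhi < 1" and hr: "\<And>t x. t \<in> {0..T} \<Longrightarrow> h t x \<in> {hlo..hhi}"
    using assms(2) unfolding hurst_function_def by auto
  obtain C where C: "0 < C" "\<And>t x y. t \<in> {0..T} \<Longrightarrow> \<bar>h t x - h t y\<bar> \<le> C * \<bar>x - y\<bar>"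
      "\<And>t t' x. t \<in> {0..T} \<Longrightarrow> t' \<in> {0..T} \<Longrightarrow> \<bar>h t x - h t' x\<bar> \<le> C * \<bar>t - t'\<bar>"
    using assms(2) unfolding hurst_function_def by blast
  \<comment> \<open>the truncation at \<open>0\<close> raises the rate beyond \<open>\<gamma>\<close> when \<open>\<gamma> < 2 * hlo - 1\<close>;
    a negative \<open>\<kappa>\<close> would break the monotonicity of the weight\<close>
  define \<kappa> where "\<kappa> = max (1/2 + \<gamma>/2 - hlo) 0"
  define \<theta> where "\<theta> = hlo - 1/2 + \<kappa>"
  have \<kappa>_bounds: "0 \<le> \<kappa>" "2 * \<kappa> < 1" and \<theta>_bounds: "0 < \<theta>" "\<theta> \<le> 1" "\<gamma> \<le> 2 * \<theta>"
    using assms(3) hb by (auto simp: \<kappa>_def \<theta>_def max_def field_simps)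
  interpret hurst_kernel T \<kappa> \<theta> C h
  proof
    show "h t x - 1/2 + \<kappa> \<in> {\<theta>..1}" if "t \<in> {0..T}" for t x
      using hr[OF that, of x] hb \<kappa>_bounds by (auto simp: \<theta>_def)
  qed (use assms(1) \<kappa>_bounds \<theta>_bounds C in auto)
  obtain K where K: "0 < K" and err: "\<And>(M :: 'a measure) F B X N Y t. brownian_motion M F T B \<Longrightarrow>
      volterra_solution M F T B h X \<Longrightarrow> 1 \<le> N \<Longrightarrow> euler_maruyama_scheme M F T B h N Y \<Longrightarrow> t \<in> {0..T} \<Longrightarrow>
      (\<integral>\<^sup>+\<omega>. ennreal ((X t \<omega> - Y t \<omega>)\<^sup>2) \<partial>M) \<le> ennreal (K * (T / real N) powr (2*\<theta>))"
    using strong_error[where 'a='a] by blast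
  \<comment> \<open>\<open>T / N \<le> T\<close>, so the surplus \<open>2 * \<theta> - \<gamma>\<close> in the rate costs only a constant\<close>
  define C' where "C' = K * T powr (2*\<theta> - \<gamma>)"
  have C': "0 < C'" using K assms(1) by (simp add: C'_def)
  have ml: "1 \<le> mittag_leffler hlo (C' * Gamma hlo * T powr hlo)"
    using C' hb Gamma_real_pos[of hlo] by (intro mittag_leffler_ge_1) auto
  show ?thesis
  proof (intro exI[of _ C'] conjI allI impI C' SUP_least)
    fix M :: "'a measure" and F B X N Y t
    assume bm: "brownian_motion M F T B" and X: "volterra_solution M F T B h X" and N: "1 \<le> N"
      and Y: "euler_maruyama_scheme M F T B h N Y" and t: "t \<in> {0..T}"
    let ?\<Delta> = "T / real N"
    have \<Delta>: "0 < ?\<Delta>" "?\<Delta> \<le> T" using assms(1) N by (auto simp: field_simps)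
    have "?\<Delta> powr (2*\<theta>) = ?\<Delta> powr (2*\<theta> - \<gamma>) * ?\<Delta> powr \<gamma>" by (simp flip: powr_add)
    also have "\<dots> \<le> T powr (2*\<theta> - \<gamma>) * ?\<Delta> powr \<gamma>"
      using \<Delta> \<theta>_bounds by (intro mult_right_mono powr_mono2) auto
    finally have "K * ?\<Delta> powr (2*\<theta>) \<le> C' * ?\<Delta> powr \<gamma>"
      using mult_left_mono[of _ _ K] K by (simp add: C'_def mult.assoc)
    also have "\<dots> \<le> C' * mittag_leffler hlo (C' * Gamma hlo * T powr hlo) * \<bar>?\<Delta>\<bar> powr \<gamma>"
      unfolding abs_of_pos[OF \<Delta>(1)] using ml C' by (intro mult_right_mono) auto
    finally have "ennreal (K * ?\<Delta> powr (2*\<theta>))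
        \<le> ennreal (C' * mittag_leffler hlo (C' * Gamma hlo * T powr hlo) * \<bar>?\<Delta>\<bar> powr \<gamma>)"
      by (rule ennreal_leI)
    with err[OF bm X N Y t]
    show "(\<integral>\<^sup>+\<omega>. ennreal (\<bar>X t \<omega> - Y t \<omega>\<bar>\<^sup>2) \<partial>M)
        \<le> ennreal (C' * mittag_leffler hlo (C' * Gamma hlo * T powr hlo) * \<bar>?\<Delta>\<bar> powr \<gamma>)"
      by simp
  qed
qed

end
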